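(* Let $0<\beta\le 1$ and $\lambda>0$, and let $Q_\beta^f(t)=N_\beta(D_f(t))$, $t\ge 0$, where $\{N_\beta(t)\}_{t\ge0}$ is the fractional Poisson process with parameters $\beta,\lambda$ and $\{D_f(t)\}_{t\ge0}$ is a subordinator independent of it with $\mathbb{E}[(D_f(t))^\rho]<\infty$ for all $\rho>0$. Then the one-dimensional distributions of $\{Q_\beta^f(t)\}_{t\ge0}$ are given by $$\mathbb{P}[Q_{\beta}^{f}(t)=n]=\frac{\lambda^n}{n!}\sum_{k=0}^{\infty}\frac{(n+k)!}{k!}\frac{(-\lambda)^k}{\Gamma(\beta(k+n)+1)}\,\mathbb{E}\big[(D_{f}(t))^{\beta(n+k)}\big],\qquad n=0,1,2,\dots$$
   Context: Subordinator: $\{D_f(t)\}_{t\ge 0}$ is a nondecreasing Lévy process with $D_f(0)=0$ a.s. and $\mathbb{E}[e^{-sD_f(t)}]=e^{-tf(s)}$, $s>0$, where $f$ is the Bernstein function $f(s)=bs+\int_0^\infty(1-e^{-sx})\,\nu(dx)$, with $b\ge0$ and $\nu$ a non-negative Lévy measure on $(0,\infty)$ satisfying $\int_0^\infty (x\wedge1)\,\nu(dx)<\infty$ and $\nu(0,\infty)=\infty$ (so sample paths are a.s. strictly increasing). Fractional Poisson process (FPP): for $0<\beta<1$, let $\{D_\beta(t)\}$ be the $\beta$-stable subordinator, $\mathbb{E}[e^{-sD_\beta(t)}]=e^{-ts^\beta}$, and $E_\beta(t)=\inf\{r\ge0: D_\beta(r)>t\}$ the inverse $\beta$-stable subordinator.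 The FPP is $N_\beta(t)=N_\beta(t,\lambda)=N(E_\beta(t),\lambda)$, where $\{N(t,\lambda)\}$ is a Poisson process of rate $\lambda>0$ independent of $E_\beta$. For $\beta=1$ the FPP is the Poisson process of rate $\lambda$.
   Formalization: The formula is proved for each t and n for which the displayed series converges (possibly conditionally); finite moments do not ensure this: for β=1, a gamma subordinator, n=0, λ>1 and t>0 the series diverges. *)

theory Defs
  imports "HOL-Probability.Probability"
begin

text \<open>
  Processes are functions of type \<open>real \<Rightarrow> 'a \<Rightarrow> _\<close>; only the time indices \<open>t \<ge> 0\<close> matter.
  Path properties are required almost surely, as in the usual definition of a Levy process.
  Hence composed and inverse processes are, in general, measurable only for the completed
  sigma-algebra, and independence of processes is stated over \<open>completion M\<close>.  For processes
  that are already measurable over \<open>M\<close> this is independence over \<open>M\<close>.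
\<close>

definition cadlag :: "(real \<Rightarrow> real) \<Rightarrow> bool" where
  "cadlag x \<longleftrightarrow>
     (\<forall>t\<ge>0. continuous (at_right t) x) \<and> (\<forall>t>0. \<exists>l. (x \<longlongrightarrow> l) (at_left t))"

definition levy_process :: "'a measure \<Rightarrow> (real \<Rightarrow> 'a \<Rightarrow> real) \<Rightarrow> bool" where
  "levy_process M X \<longleftrightarrow>
     (\<forall>t\<ge>0. X t \<in> borel_measurable M) \<and>
     (AE \<omega> in M. X 0 \<omega> = 0) \<and>
     (\<forall>(n::nat) \<tau>. 0 \<le> \<tau> 0 \<and> (\<forall>i<n. \<tau> i \<le> \<tau> (Suc i)) \<longrightarrow>
        prob_space.indep_vars M (\<lambda>_. borel) (\<lambda>i \<omega>. X (\<tau> (Suc i)) \<omega> - X (\<tau> i) \<omega>) {..<n}) \<and>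
     (\<forall>s\<ge>0. \<forall>h\<ge>0. distr M borel (\<lambda>\<omega>. X (s + h) \<omega> - X s \<omega>) = distr M borel (X h)) \<and>
     (\<forall>t\<ge>0. \<forall>\<epsilon>>0.
        ((\<lambda>s. measure M {\<omega> \<in> space M. \<epsilon> < \<bar>X s \<omega> - X t \<omega>\<bar>}) \<longlongrightarrow> 0) (at t within {0..})) \<and>
     (AE \<omega> in M. cadlag (\<lambda>t. X t \<omega>))"

text \<open>Levy measures of subordinators with almost surely strictly increasing paths;
  \<open>\<nu>\<close> lives on the half-line \<open>(0, \<infinity>)\<close>.\<close>

definition subordinator_levy_measure :: "real measure \<Rightarrow> bool" where
  "subordinator_levy_measure \<nu> \<longleftrightarrow>
     sets \<nu> = sets borel \<and> emeasure \<nu> {..0} = 0 \<and>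
     (\<integral>\<^sup>+x. ennreal (min x 1) \<partial>\<nu>) < \<infinity> \<and> emeasure \<nu> {0<..} = \<infinity>"

definition bernstein_exponent :: "(real \<Rightarrow> real) \<Rightarrow> bool" where
  "bernstein_exponent f \<longleftrightarrow>
     (\<exists>b \<nu>. b \<ge> 0 \<and> subordinator_levy_measure \<nu> \<and>
        (\<forall>s>0. f s = b * s + (\<integral>x. (1 - exp (- s * x)) \<partial>\<nu>)))"

definition subordinator :: "'a measure \<Rightarrow> (real \<Rightarrow> real) \<Rightarrow> (real \<Rightarrow> 'a \<Rightarrow> real) \<Rightarrow> bool" where
  "subordinator M f D \<longleftrightarrow>
     levy_process M D \<and> (AE \<omega> in M. mono_on {0..} (\<lambda>t. D t \<omega>)) \<and>
     bernstein_exponent f \<and>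
     (\<forall>t\<ge>0. \<forall>s>0. (\<integral>\<omega>. exp (- s * D t \<omega>) \<partial>M) = exp (- t * f s))"

definition inverse_process :: "(real \<Rightarrow> 'a \<Rightarrow> real) \<Rightarrow> real \<Rightarrow> 'a \<Rightarrow> real" where
  "inverse_process D t \<omega> = Inf {r. 0 \<le> r \<and> D r \<omega> > t}"

definition poisson_process :: "'a measure \<Rightarrow> real \<Rightarrow> (real \<Rightarrow> 'a \<Rightarrow> nat) \<Rightarrow> bool" where
  "poisson_process M r N \<longleftrightarrow>
     levy_process M (\<lambda>t \<omega>. real (N t \<omega>)) \<and>
     (\<forall>t>0. distr M (count_space UNIV) (N t) = measure_pmf (poisson_pmf (r * t)))"

definition indep_processes ::
    "'a measure \<Rightarrow> (real \<Rightarrow> 'a \<Rightarrow> real) \<Rightarrow> (real \<Rightarrow> 'a \<Rightarrow> real) \<Rightarrow> bool" where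
  "indep_processes M X Y \<longleftrightarrow>
     prob_space.indep_var (completion M)
       (\<Pi>\<^sub>M t\<in>{0..}. borel) (\<lambda>\<omega>. \<lambda>t\<in>{0..}. X t \<omega>)
       (\<Pi>\<^sub>M t\<in>{0..}. borel) (\<lambda>\<omega>. \<lambda>t\<in>{0..}. Y t \<omega>)"

definition time_change :: "(real \<Rightarrow> 'a \<Rightarrow> 'b) \<Rightarrow> (real \<Rightarrow> 'a \<Rightarrow> real) \<Rightarrow> real \<Rightarrow> 'a \<Rightarrow> 'b" where
  "time_change X T t \<omega> = X (T t \<omega>) \<omega>"

text \<open>For \<open>0 < \<beta> < 1\<close> the \<open>\<beta>\<close>-stable subordinator is the subordinator with exponent
  \<open>s powr \<beta>\<close>.\<close>

definition fractional_poisson_process ::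
    "'a measure \<Rightarrow> real \<Rightarrow> real \<Rightarrow> (real \<Rightarrow> 'a \<Rightarrow> nat) \<Rightarrow> bool" where
  "fractional_poisson_process M \<beta> r N\<^sub>\<beta> \<longleftrightarrow>
     (if \<beta> = 1 then poisson_process M r N\<^sub>\<beta>
      else \<exists>D N. subordinator M (\<lambda>s. s powr \<beta>) D \<and> poisson_process M r N \<and>
             indep_processes M (\<lambda>t \<omega>. real (N t \<omega>)) (inverse_process D) \<and>
             (\<forall>t\<ge>0. \<forall>\<omega>\<in>space M. N\<^sub>\<beta> t \<omega> = time_change N (inverse_process D) t \<omega>))"

text \<open>Unlike \<open>powr\<close>, which has \<open>0 powr 0 = 0\<close>, this satisfies \<open>0\<^sup>0 = 1\<close>; the difference
  matters for the zeroth moment at time \<open>0\<close>.\<close>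

definition real_power :: "real \<Rightarrow> real \<Rightarrow> real" where
  "real_power x a = (if a = 0 then 1 else x powr a)"

definition fractional_moment :: "'a measure \<Rightarrow> ('a \<Rightarrow> real) \<Rightarrow> real \<Rightarrow> real" where
  "fractional_moment M X \<rho> = (\<integral>\<omega>. real_power (X \<omega>) \<rho> \<partial>M)"

end

theory Submission
  imports Defs
begin

text \<open>
  The inverse stable subordinator at time \<open>x\<close> has the law of \<open>x powr \<beta> * V\<close> with
  \<open>V = D 1 powr (- \<beta>)\<close>, by self-similarity of \<open>D\<close>, and \<open>V\<close> has the moments
  \<open>m! / \<Gamma> (\<beta> m + 1)\<close>.  Conditioning the Poisson process on the independent random time and
  expanding the exponential gives the one-dimensional laws of the fractional Poisson process, and
  conditioning once more on \<open>D\<^sub>f t\<close> gives the claim, provided that expectation and series can be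
  interchanged.  As the series is only assumed to converge, dominated convergence does not apply at
  the rate \<open>r\<close>; it does at every smaller rate \<open>z\<close>, where the power series converges absolutely.
  Letting \<open>z\<close> increase to \<open>r\<close>, the series is handled by Abel's limit theorem and the expectation
  by the bound \<open>exp (- z u) * u ^ n \<le> n! / z ^ n\<close>.
\<close>

text \<open>Finite moments of \<open>D\<^sub>f t\<close> do not make the series converge. Take
  \<beta> = 1, n = 0 and a gamma subordinator of rate c: the terms are
  \<open>(- r / c) ^ k * Gamma (t + k) / (Gamma t * k!)\<close>. For r > c the series diverges
  although the probability is well defined, and for r = c and 0 < t < 1 it converges only
  conditionally. Convergence is therefore a hypothesis, and without absolute convergence the
  boundary rate has to be reached as a limit.

  The stable subordinator is known only through its Laplace transform
  \<open>exp (- u * s powr \<beta>)\<close>; no density is available. Positivity, unboundedness,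
  self-similarity and the negative moments are all read off from this transform. The numbers m! /
  \<Gamma> (\<beta> m + 1) are the moments of the Mittag-Leffler law, which for \<beta> = 1 is the
  point mass at 1, so that the ordinary Poisson process fits the same scheme.\<close>

section \<open>Abel summation, a Gamma bound and Laplace transforms\<close>

text \<open>Summation by parts: \<open>a k = R k - R (Suc k)\<close> for the tails \<open>R\<close>,
  so the power series at \<open>y\<close> differs from \<open>suminf a\<close> by
  \<open>1 - y\<close> times a power series in the tails. The factor \<open>1 - y\<close> makes the
  first \<open>N\<close> terms negligible and normalises the geometric series that bounds the
  others.\<close>

lemma abel_limit:
  fixes a :: "nat \<Rightarrow> real" and x :: "nat \<Rightarrow> real"
  assumes a: "summable a" and x: "x \<longlonglongrightarrow> 1" "\<And>j. 0 \<le> x j" "\<And>j. x j < 1"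
  shows "(\<lambda>j. \<Sum>k. a k * x j ^ k) \<longlonglongrightarrow> suminf a"
proof -
  define R where "R k = suminf a - sum a {..<k}" for k
  have R0: "R \<longlonglongrightarrow> 0"
    using tendsto_diff[OF tendsto_const summable_LIMSEQ[OF a], of "suminf a"] by (simp add: R_def[abs_def])
  then obtain B where B: "\<And>k. \<bar>R k\<bar> \<le> B"
    using convergentI[THEN convergent_imp_Bseq, OF R0] unfolding Bseq_def by auto
  have B0: "0 \<le> B" using B[of 0] by linarith
  have sR: "summable (\<lambda>k. R (f k) * y ^ k)" if "0 \<le> y" "y < 1" for y f
    by (rule summable_comparison_test'[where g = "\<lambda>k. B * y ^ k"])
       (use that B in \<open>auto simp: abs_mult power_abs intro!: mult_right_mono summable_mult summable_geometric\<close>)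
  have eq: "(\<Sum>k. a k * y ^ k) = suminf a - (1 - y) * (\<Sum>k. R (Suc k) * y ^ k)"
    if y: "0 \<le> y" "y < 1" for y
  proof -
    have s: "summable (\<lambda>k. R k * y ^ k)" "summable (\<lambda>k. R (Suc k) * y ^ k)"
      using sR[OF y, of "\<lambda>k. k"] sR[OF y, of Suc] by auto
    have "(\<Sum>k. a k * y ^ k) = (\<Sum>k. R k * y ^ k - R (Suc k) * y ^ k)"
      by (intro arg_cong[where f = suminf] ext) (simp add: R_def algebra_simps)
    also have "\<dots> = (\<Sum>k. R k * y ^ k) - (\<Sum>k. R (Suc k) * y ^ k)"
      by (rule suminf_diff[symmetric]) (fact s)+
    also have "(\<Sum>k. R k * y ^ k) = R 0 + y * (\<Sum>k. R (Suc k) * y ^ k)"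
      using suminf_split_head[OF s(1)] suminf_mult[OF s(2), of y] by (simp add: mult_ac)
    finally show ?thesis by (simp add: R_def algebra_simps)
  qed
  have "(\<lambda>j. (1 - x j) * (\<Sum>k. R (Suc k) * x j ^ k)) \<longlonglongrightarrow> 0"
  proof (rule LIMSEQ_I)
    fix e :: real assume e: "0 < e"
    obtain N where N: "\<And>k. k \<ge> N \<Longrightarrow> \<bar>R k\<bar> < e / 2"
      using LIMSEQ_D[OF R0, of "e/2"] e by auto
    have bnd: "\<bar>(1 - y) * (\<Sum>k. R (Suc k) * y ^ k)\<bar> \<le> (1 - y) * (N * B) + e / 2"
      if y: "0 \<le> y" "y < 1" for y
    proof -
      have s: "summable (\<lambda>k. R (Suc k) * y ^ k)" using sR[OF y, of Suc] .
      have "\<bar>\<Sum>k<N. R (Suc k) * y ^ k\<bar> \<le> (\<Sum>k<N. B)"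
        using B B0 y by (intro order_trans[OF sum_abs] sum_mono)
          (auto simp: abs_mult power_abs intro!: order_trans[OF mult_mono[OF B power_le_one]])
      moreover have "\<bar>\<Sum>k. R (Suc (k + N)) * y ^ (k + N)\<bar> \<le> (\<Sum>k. e / 2 * y ^ k)"
      proof -
        have *: "norm (R (Suc (k + N)) * y ^ (k + N)) \<le> e / 2 * y ^ k" for k
        proof -
          have "\<bar>R (Suc (k + N))\<bar> * y ^ (k + N) \<le> e / 2 * y ^ k"
            using N[of "Suc (k + N)"] y e by (intro mult_mono power_decreasing) auto
          then show ?thesis using y by (simp add: abs_mult)
        qed
        have sg: "summable (\<lambda>k. e / 2 * y ^ k)"
          using y by (intro summable_mult summable_geometric) auto
        have "norm (\<Sum>k. R (Suc (k + N)) * y ^ (k + N)) \<le> (\<Sum>k. e / 2 * y ^ k)"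
          by (rule norm_suminf_le[OF * sg])
        then show ?thesis by simp
      qed
      moreover have "(\<Sum>k. e / 2 * y ^ k) = e / 2 / (1 - y)"
        using y by (subst suminf_mult) (auto simp: suminf_geometric summable_geometric)
      moreover have "(\<Sum>k. R (Suc k) * y ^ k) = (\<Sum>k. R (Suc (k + N)) * y ^ (k + N)) + (\<Sum>k<N. R (Suc k) * y ^ k)"
        using suminf_split_initial_segment[OF s, of N] by simp
      ultimately have "\<bar>\<Sum>k. R (Suc k) * y ^ k\<bar> \<le> N * B + e / 2 / (1 - y)" by simp
      then have "(1 - y) * \<bar>\<Sum>k. R (Suc k) * y ^ k\<bar> \<le> (1 - y) * (N * B + e / 2 / (1 - y))"
        using y by (intro mult_left_mono) auto
      also have "\<dots> = (1 - y) * (N * B) + e / 2" using y by (simp add: field_simps)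
      finally show ?thesis using y by (simp add: abs_mult)
    qed
    show "\<exists>no. \<forall>j\<ge>no. norm ((1 - x j) * (\<Sum>k. R (Suc k) * x j ^ k) - 0) < e"
    proof -
      have "(\<lambda>j. (1 - x j) * (N * B)) \<longlonglongrightarrow> (1 - 1) * (N * B)"
        by (intro tendsto_intros x)
      then obtain M where M: "\<And>j. j \<ge> M \<Longrightarrow> \<bar>(1 - x j) * (N * B)\<bar> < e / 2"
        using LIMSEQ_D[of _ "(1 - 1) * (N * B)" "e / 2"] e by fastforce
      show ?thesis
        using M bnd[OF x(2,3)] by (intro exI[of _ M]) (fastforce intro: le_less_trans)
    qed
  qed
  then show ?thesis
    using eq x(2,3) tendsto_diff[OF tendsto_const, of _ 0 _ "suminf a"] by simp
qed

text \<open>On \<open>{a..}\<close> the factor \<open>t powr y\<close> of Euler's integral is at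
  least \<open>a powr y\<close>. Since \<open>a\<close> is free, Gamma outgrows every geometric
  sequence along \<open>y = \<beta> * m\<close>.\<close>

lemma Gamma_lower_bound:
  fixes a y :: real
  assumes "0 < a" "0 \<le> y"
  shows "a powr y * exp (- a) \<le> Gamma (y + 1)"
proof -
  have "((\<lambda>t. a powr y * exp (- 1 * t)) has_integral a powr y * (exp (- 1 * a) / 1)) {a..}"
    by (intro has_integral_mult_right has_integral_exp_minus_to_infinity) auto
  then have 1: "((\<lambda>t. if t \<in> {a..} then a powr y * exp (- t) else 0) has_integral a powr y * exp (- a)) {0..}"
    using assms by (subst has_integral_restrict) auto
  have 2: "((\<lambda>t. t powr y / exp t) has_integral Gamma (y + 1)) {0..}"
    using Gamma_integral_real[of "y + 1"] assms by simp
  show ?thesis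
    by (rule has_integral_le[OF 1 2])
      (use assms in \<open>auto simp: exp_minus field_simps intro!: powr_mono2\<close>)
qed

text \<open>The substitution \<open>z = exp (- x)\<close> turns the transforms at natural numbers
  into moments on [0, 1]. By Weierstrass approximation these determine the integrals of all
  continuous step functions, and hence the law.\<close>

lemma laplace_unique:
  fixes \<mu> \<nu> :: "real measure"
  assumes "real_distribution \<mu>" "real_distribution \<nu>"
    and pos: "AE x in \<mu>. 0 \<le> x" "AE x in \<nu>. 0 \<le> x"
    and eq: "\<And>s. 0 < s \<Longrightarrow> (\<integral>x. exp (- s * x) \<partial>\<mu>) = (\<integral>x. exp (- s * x) \<partial>\<nu>)"
  shows "\<mu> = \<nu>"
proof -
  interpret \<mu>: real_distribution \<mu> by fact
  interpret \<nu>: real_distribution \<nu> by fact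
  have int: "integrable L (\<lambda>x. exp (- real i * x))" 
    if "real_distribution L" "AE x in L. 0 \<le> x" for i L
  proof -
    interpret L: real_distribution L by fact
    show ?thesis
      by (rule L.integrable_const_bound[where B = 1]) (use that(2) in auto)
  qed
  \<comment> \<open>The hypothesis covers \<open>0 < s\<close> only; the value at
    \<open>i = 0\<close> is the total mass 1.\<close>
  have eqi: "(\<integral>x. exp (- real i * x) \<partial>\<mu>) = (\<integral>x. exp (- real i * x) \<partial>\<nu>)" for i
    using eq[of "real i"] by (cases "i = 0") (use \<mu>.prob_space \<nu>.prob_space in auto)
  have step: "(\<integral>x. cts_step a b x \<partial>\<mu>) = (\<integral>x. cts_step a b x \<partial>\<nu>)" if ab: "a < b" for a b
  proof -
    \<comment> \<open>\<open>h\<close> extends \<open>cts_step a b\<close>, read as a function of \<open>exp (- x)\<close>, continuously to the point \<open>0\<close>.\<close>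
    define h where "h z = cts_step a b (- ln (max z (exp (- b - 1))))" for z
    have pos': "0 < max z (exp (- b - 1))" for z :: real by (simp add: less_max_iff_disj)
    have cont: "continuous_on UNIV (cts_step a b)"
      by (rule uniformly_continuous_imp_continuous[OF cts_step_uniformly_continuous[OF ab]])
    have conth: "continuous_on {0..1} h"
      unfolding h_def using pos'
      by (intro continuous_on_compose2[OF cont] continuous_intros) (auto simp: less_imp_neq[symmetric])
    \<comment> \<open>\<open>cts_step a b\<close> vanishes from \<open>b\<close> on, so replacing
      \<open>x\<close> by \<open>min x (b + 1)\<close> leaves its value unchanged.\<close>
    have h: "h (exp (- x)) = cts_step a b x" for x
    proof -
      have "max (exp (- x)) (exp (- b - 1)) = exp (- min x (b + 1))"
        by (auto simp: max_def min_def)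
      then show ?thesis unfolding h_def using ab by (auto simp: cts_step_def min_def)
    qed
    have "\<bar>(\<integral>x. cts_step a b x \<partial>\<mu>) - (\<integral>x. cts_step a b x \<partial>\<nu>)\<bar> \<le> e" if e: "0 < e" for e
    proof -
      obtain g where g: "real_polynomial_function g" "\<And>z. z \<in> {0..1} \<Longrightarrow> \<bar>h z - g z\<bar> < e / 2"
        using Stone_Weierstrass_real_polynomial_function[OF _ conth, of "e/2"] e by auto
      obtain c m where g_sum: "g = (\<lambda>z. \<Sum>i\<le>m. c i * z ^ i)"
        using g(1) unfolding real_polynomial_function_iff_sum by auto
      have gexp: "g (exp (- x)) = (\<Sum>i\<le>m. c i * exp (- real i * x))" for x
        by (simp add: g_sum exp_of_nat_mult[symmetric])
      have bnd: "integrable L (\<lambda>x. g (exp (- x)))" "\<bar>(\<integral>x. cts_step a b x \<partial>L) - (\<integral>x. g (exp (- x)) \<partial>L)\<bar> \<le> e / 2"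
        "(\<integral>x. g (exp (- x)) \<partial>L) = (\<Sum>i\<le>m. c i * (\<integral>x. exp (- real i * x) \<partial>L))"
        if L: "real_distribution L" "AE x in L. 0 \<le> x" for L
      proof -
        interpret L: real_distribution L by fact
        show i1: "integrable L (\<lambda>x. g (exp (- x)))"
          unfolding gexp using int[OF L] by auto
        have i2: "integrable L (cts_step a b)" using ab by (rule L.integrable_cts_step)
        have "(\<integral>x. cts_step a b x \<partial>L) - (\<integral>x. g (exp (- x)) \<partial>L) = (\<integral>x. cts_step a b x - g (exp (- x)) \<partial>L)"
          by (rule Bochner_Integration.integral_diff[symmetric]) (fact i1 i2)+
        also have "\<bar>\<dots>\<bar> \<le> (\<integral>x. \<bar>cts_step a b x - g (exp (- x))\<bar> \<partial>L)"
          by (rule integral_abs_bound)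
        also have "\<dots> \<le> (\<integral>x. e / 2 \<partial>L)"
        proof (intro integral_mono_AE integrable_abs Bochner_Integration.integrable_diff i1 i2)
          show "AE x in L. \<bar>cts_step a b x - g (exp (- x))\<bar> \<le> e / 2"
            using L(2)
          proof eventually_elim
            case (elim x)
            then show ?case using g(2)[of "exp (- x)"] by (simp add: h)
          qed
        qed auto
        also have "\<dots> = e / 2" using L.prob_space by simp
        finally show "\<bar>(\<integral>x. cts_step a b x \<partial>L) - (\<integral>x. g (exp (- x)) \<partial>L)\<bar> \<le> e / 2" .
        show "(\<integral>x. g (exp (- x)) \<partial>L) = (\<Sum>i\<le>m. c i * (\<integral>x. exp (- real i * x) \<partial>L))"
          unfolding gexp using int[OF L] by (subst Bochner_Integration.integral_sum) auto
      qed
      from bnd(2,3)[OF assms(1) pos(1)] bnd(2,3)[OF assms(2) pos(2)]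
      show ?thesis unfolding eqi by linarith
    qed
    then show ?thesis
      by (metis abs_le_zero_iff eq_iff_diff_eq_0 field_le_epsilon add_0)
  qed
  \<comment> \<open>The sequence is constant; weak convergence is only the bridge from step
    functions to characteristic functions.\<close>
  have "weak_conv_m (\<lambda>_. \<mu>) \<nu>"
    by (rule integral_cts_step_conv_imp_weak_conv) (use assms step in auto)
  then have "(\<lambda>_::nat. char \<mu> t) \<longlonglongrightarrow> char \<nu> t" for t
    by (intro levy_continuity1 assms)
  then have "char \<mu> = char \<nu>"
    by (auto simp: LIMSEQ_const_iff)
  then show ?thesis
    by (intro Levy_uniqueness assms)
qed

section \<open>Processes at independent random times\<close>

text \<open>The random time is approximated from the right by its values on the grids
  \<open>{j / (m + 1)}\<close>: on a grid the composed process is measurable for the product sigma-algebra, and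
  right-continuity of the paths yields the limit.\<close>

lemma random_time_distribution:
  fixes X :: "real \<Rightarrow> 'a \<Rightarrow> nat" and Y :: "real \<Rightarrow> 'a \<Rightarrow> real" and q :: "real \<Rightarrow> real"
  assumes "prob_space M" and indep: "indep_processes M (\<lambda>s \<omega>. real (X s \<omega>)) Y"
    and rc: "AE \<omega> in M. \<forall>s\<ge>0. continuous (at_right s) (\<lambda>s. real (X s \<omega>))"
    and t: "0 \<le> t" and nonneg: "AE \<omega> in M. 0 \<le> Y t \<omega>"
    and q_meas: "q \<in> borel_measurable borel"
    and q: "\<And>s. 0 \<le> s \<Longrightarrow> measure (completion M) {\<omega> \<in> space M. X s \<omega> = n} = q s"
  shows "measure (completion M) {\<omega> \<in> space M. time_change X Y t \<omega> = n} = (\<integral>\<omega>. q (Y t \<omega>) \<partial>completion M)"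
proof -
  interpret P: prob_space M by fact
  define C where "C = completion M"
  have spC: "space C = space M" by (simp add: C_def)
  interpret C: prob_space C
    unfolding C_def by (intro prob_spaceI) (simp add: P.emeasure_space_1)
  interpret C: complete_measure C
    unfolding C_def by unfold_locales
  define S where "S = (\<Pi>\<^sub>M t\<in>{0::real..}. (borel :: real measure))"
  define X' where "X' \<omega> = (\<lambda>t\<in>{0..}. real (X t \<omega>))" for \<omega>
  define Y' where "Y' \<omega> = (\<lambda>t\<in>{0..}. Y t \<omega>)" for \<omega>
  have ind: "C.indep_var S X' S Y'"
    using indep by (simp add: indep_processes_def S_def X'_def[abs_def] Y'_def[abs_def] C_def)
  note [measurable] = C.indep_var_rv1[OF ind] C.indep_var_rv2[OF ind] q_meas
  have S_meas: "(\<lambda>x. x s) \<in> borel_measurable S" if "0 \<le> s" for s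
    unfolding S_def using that by (intro measurable_component_singleton) simp
  have Xm: "(\<lambda>\<omega>. real (X s \<omega>)) \<in> borel_measurable C" if "0 \<le> s" for s
    using measurable_compose[OF C.indep_var_rv1[OF ind] S_meas[OF that]] that by (simp add: X'_def)
  have Ym[measurable]: "Y t \<in> borel_measurable C"
    using measurable_compose[OF C.indep_var_rv2[OF ind] S_meas[OF t]] t by (simp add: Y'_def)
  have rcC: "AE \<omega> in C. \<forall>s\<ge>0. continuous (at_right s) (\<lambda>s. real (X s \<omega>))"
    unfolding C_def by (rule AE_completion[OF rc])
  have nonnegC: "AE \<omega> in C. 0 \<le> Y t \<omega>"
    unfolding C_def by (rule AE_completion[OF nonneg])
  define I where "I x = (indicator {real n} x :: real)" for x
  have [measurable]: "I \<in> borel_measurable borel" unfolding I_def[abs_def] by measurable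
  have I_bnd[simp]: "\<bar>I x\<bar> \<le> 1" for x by (simp add: I_def)
  have q_I: "q s = (\<integral>\<omega>. I (X s \<omega>) \<partial>C)" if "0 \<le> s" for s
  proof -
    have "(\<integral>\<omega>. I (X s \<omega>) \<partial>C) = (\<integral>\<omega>. indicator {\<omega> \<in> space M. X s \<omega> = n} \<omega> \<partial>C)"
      by (rule Bochner_Integration.integral_cong) (auto simp: I_def spC split: split_indicator)
    also have "\<dots> = measure C {\<omega> \<in> space M. X s \<omega> = n}"
      by (simp add: spC[symmetric] Int_absorb2)
    finally show ?thesis using q[OF that] by (simp add: C_def)
  qed
  have I_right: "(\<lambda>m. I (X (u m) \<omega>)) \<longlonglongrightarrow> I (X s \<omega>)"
    if c: "continuous (at_right s) (\<lambda>s. real (X s \<omega>))" and u: "u \<longlonglongrightarrow> s" "\<And>m. s < u m" for u :: "nat \<Rightarrow> real" and s \<omega>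
  proof -
    have "filterlim u (at_right s) sequentially"
      using u by (auto simp: filterlim_at intro!: always_eventually)
    then have "(\<lambda>m. real (X (u m) \<omega>)) \<longlonglongrightarrow> real (X s \<omega>)"
      using c unfolding continuous_within by (rule filterlim_compose[rotated])
    \<comment> \<open>Distinct natural numbers are at distance at least 1, so the convergent values
      are eventually constant and even the discontinuous \<open>I\<close> passes to the
      limit.\<close>
    then have "eventually (\<lambda>m. dist (real (X (u m) \<omega>)) (real (X s \<omega>)) < 1) sequentially"
      by (rule tendstoD) simp
    then have "eventually (\<lambda>m. I (X (u m) \<omega>) = I (X s \<omega>)) sequentially"
    proof eventually_elim
      case (elim m)
      then have "X (u m) \<omega> = X s \<omega>" by (simp add: dist_real_def)
      then show ?case by simp
    qed
    then show ?thesis by (rule tendsto_eventually)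
  qed
  \<comment> \<open>Right-continuity of \<open>q\<close> is inherited from the paths by dominated
    convergence.\<close>
  have q_right: "(\<lambda>m. q (u m)) \<longlonglongrightarrow> q s"
    if u: "u \<longlonglongrightarrow> s" "\<And>m. s < u m" and s: "0 \<le> s" for u :: "nat \<Rightarrow> real" and s
  proof -
    have u0: "0 \<le> u m" for m using u(2)[of m] s by simp
    note [measurable] = Xm[OF u0] Xm[OF s]
    have "AE \<omega> in C. (\<lambda>m. I (X (u m) \<omega>)) \<longlonglongrightarrow> I (X s \<omega>)"
      using rcC by eventually_elim (use s in \<open>auto intro!: I_right u\<close>)
    then have "(\<lambda>m. \<integral>\<omega>. I (X (u m) \<omega>) \<partial>C) \<longlonglongrightarrow> (\<integral>\<omega>. I (X s \<omega>) \<partial>C)"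
      by (intro integral_dominated_convergence[where w = "\<lambda>_. 1"]) auto
    then show ?thesis using q_I u0 s by simp
  qed
  define J where "J m \<omega> = nat \<lfloor>real (Suc m) * Y t \<omega>\<rfloor>" for m \<omega>
  \<comment> \<open>The summand 1 puts the grid point strictly to the right of
    \<open>Y t \<omega>\<close>, even when \<open>Y t \<omega>\<close> lies on the grid;
    \<open>I_right\<close> asks for strict approach.\<close>
  define g where "g m j = (real j + 1) / real (Suc m)" for m j
  have g0: "0 \<le> g m j" for m j by (simp add: g_def)
  have J_meas[measurable]: "J m \<in> measurable C (count_space UNIV)" for m
    unfolding J_def[abs_def] by measurable
  have grid: "(\<integral>\<omega>. I (X (g m (J m \<omega>)) \<omega>) \<partial>C) = (\<integral>\<omega>. q (g m (J m \<omega>)) \<partial>C)" for m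
  proof -
    define J' where "J' y = nat \<lfloor>real (Suc m) * y t\<rfloor>" for y :: "real \<Rightarrow> real"
    have J'[measurable]: "J' \<in> measurable S (count_space UNIV)"
      using S_meas[OF t] unfolding J'_def[abs_def] by measurable
    have JJ: "J' \<circ> Y' = J m" using t by (auto simp: J'_def Y'_def J_def)
    have ind': "distr C S X' \<Otimes>\<^sub>M distr C S Y' = distr C (S \<Otimes>\<^sub>M S) (\<lambda>x. (X' x, Y' x))"
      using ind unfolding C.indep_var_distribution_eq by simp
    interpret DX: prob_space "distr C S X'" by (rule C.prob_space_distr) measurable
    interpret DY: prob_space "distr C S Y'" by (rule C.prob_space_distr) measurable
    interpret DD: pair_prob_space "distr C S X'" "distr C S Y'" ..
    define h where "h z = I (fst z (g m (J' (snd z))))" for z :: "(real \<Rightarrow> real) \<times> (real \<Rightarrow> real)"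
    \<comment> \<open>\<open>J'\<close> takes countably many values, so evaluation at the random
      index splits into evaluations at fixed times.\<close>
    have h_meas[measurable]: "h \<in> borel_measurable (S \<Otimes>\<^sub>M S)"
      unfolding h_def[abs_def]
      by (rule measurable_compose_countable[where g = "\<lambda>z. J' (snd z)" and f = "\<lambda>j z. I (fst z (g m j))"])
        (use S_meas[OF g0] in measurable)
    have "(\<integral>\<omega>. I (X (g m (J m \<omega>)) \<omega>) \<partial>C) = (\<integral>\<omega>. h (X' \<omega>, Y' \<omega>) \<partial>C)"
      using g0 by (simp add: h_def X'_def JJ[symmetric])
    also have "\<dots> = (\<integral>z. h z \<partial>distr C (S \<Otimes>\<^sub>M S) (\<lambda>x. (X' x, Y' x)))"
      by (subst integral_distr) auto
    \<comment> \<open>Independence enters here: the joint law is a product, and Fubini then freezes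
      the time coordinate.\<close>
    also have "\<dots> = (\<integral>z. h z \<partial>(distr C S X' \<Otimes>\<^sub>M distr C S Y'))"
      unfolding ind' ..
    also have "\<dots> = (\<integral>y. \<integral>x. h (x, y) \<partial>distr C S X' \<partial>distr C S Y')"
    proof -
      have "integrable (distr C S X' \<Otimes>\<^sub>M distr C S Y') h"
        by (rule DD.P.integrable_const_bound[where B = 1]) (auto simp: h_def[of "(_, _)"])
      then show ?thesis
        using DD.integral_snd[of "\<lambda>x y. h (x, y)"] by simp
    qed
    also have "\<dots> = (\<integral>y. q (g m (J' y)) \<partial>distr C S Y')"
    proof (rule Bochner_Integration.integral_cong[OF refl])
      fix y assume "y \<in> space (distr C S Y')"
      then have [measurable]: "(\<lambda>x. h (x, y)) \<in> borel_measurable S"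
        by (intro measurable_compose[OF _ h_meas] measurable_Pair1') simp
      have "(\<integral>x. h (x, y) \<partial>distr C S X') = (\<integral>\<omega>. h (X' \<omega>, y) \<partial>C)"
        by (subst integral_distr) auto
      also have "\<dots> = q (g m (J' y))"
        using g0[of m "J' y"] by (simp add: q_I h_def X'_def)
      finally show "(\<integral>x. h (x, y) \<partial>distr C S X') = q (g m (J' y))" .
    qed
    also have "\<dots> = (\<integral>\<omega>. q (g m (J m \<omega>)) \<partial>C)"
      by (subst integral_distr) (auto simp: JJ[symmetric])
    finally show ?thesis .
  qed
  have gJ: "y < g m (nat \<lfloor>real (Suc m) * y\<rfloor>)" "g m (nat \<lfloor>real (Suc m) * y\<rfloor>) \<le> y + 1 / real (Suc m)"
    if "0 \<le> y" for m y
  proof -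
    have 1: "real (nat \<lfloor>real (Suc m) * y\<rfloor>) = of_int \<lfloor>real (Suc m) * y\<rfloor>"
      using that by (intro of_nat_nat) auto
    show "y < g m (nat \<lfloor>real (Suc m) * y\<rfloor>)"
      unfolding g_def 1 using floor_correct[of "real (Suc m) * y"]
      by (subst pos_less_divide_eq) (auto simp: mult.commute)
    show "g m (nat \<lfloor>real (Suc m) * y\<rfloor>) \<le> y + 1 / real (Suc m)"
      unfolding g_def 1 using floor_correct[of "real (Suc m) * y"]
      by (subst pos_divide_le_eq) (auto simp: algebra_simps)
  qed
  have J_eq: "J m \<omega> = nat \<lfloor>real (Suc m) * Y t \<omega>\<rfloor>" for m \<omega> by (simp only: J_def)
  have gJ_lim: "(\<lambda>m. g m (nat \<lfloor>real (Suc m) * y\<rfloor>)) \<longlonglongrightarrow> y" if "0 \<le> y" for y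
  proof (rule tendsto_sandwich[OF _ _ tendsto_const])
    show "(\<lambda>m. y + 1 / real (Suc m)) \<longlonglongrightarrow> y"
      using tendsto_add[OF tendsto_const LIMSEQ_inverse_real_of_nat, of y] by (simp add: inverse_eq_divide)
  qed (use gJ[OF that] in \<open>auto intro!: always_eventually less_imp_le\<close>)
  have lim: "AE \<omega> in C. (\<lambda>m. I (X (g m (J m \<omega>)) \<omega>)) \<longlonglongrightarrow> I (X (Y t \<omega>) \<omega>)"
    using rcC nonnegC 
    unfolding J_eq by eventually_elim (intro I_right gJ_lim gJ; simp)
  have meas_m[measurable]: "(\<lambda>\<omega>. I (X (g m (J m \<omega>)) \<omega>)) \<in> borel_measurable C" for m
    by (rule measurable_compose_countable[where g = "J m" and f = "\<lambda>j \<omega>. I (X (g m j) \<omega>)"])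
      (use Xm[OF g0] in measurable)
  \<comment> \<open>Measurability of the composed variable is not given. The limit of the grid
    values is measurable and agrees with \<open>I (X (Y t \<omega>) \<omega>)\<close> almost surely,
    and completeness of \<open>C\<close> then makes the event measurable.\<close>
  define L where "L \<omega> = lim (\<lambda>m. I (X (g m (J m \<omega>)) \<omega>))" for \<omega>
  have L_meas[measurable]: "L \<in> borel_measurable C"
    unfolding L_def[abs_def] by measurable
  have L_eq: "AE \<omega> in C. L \<omega> = I (X (Y t \<omega>) \<omega>)"
    using lim by eventually_elim (auto simp: L_def intro: limI)
  let ?A = "{\<omega> \<in> space M. time_change X Y t \<omega> = n}"
  have A_sets: "?A \<in> sets C"
  proof (rule C.in_sets_AE)
    show "AE \<omega> in C. \<omega> \<in> {\<omega> \<in> space C. L \<omega> = 1} \<longleftrightarrow> \<omega> \<in> ?A"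
      using L_eq AE_space[of C]
      by eventually_elim (auto simp: I_def spC time_change_def split: split_indicator_asm)
    show "{\<omega> \<in> space C. L \<omega> = 1} \<in> sets C" by measurable
  qed (auto simp: spC)
  have "measure C ?A = (\<integral>\<omega>. indicator ?A \<omega> \<partial>C)"
    using A_sets by simp
  also have "\<dots> = (\<integral>\<omega>. L \<omega> \<partial>C)"
    using A_sets L_eq AE_space[of C]
    by (intro integral_cong_AE) (auto simp: I_def spC time_change_def split: split_indicator)
  finally have 1: "measure C ?A = (\<integral>\<omega>. L \<omega> \<partial>C)" .
  have "AE \<omega> in C. (\<lambda>m. I (X (g m (J m \<omega>)) \<omega>)) \<longlonglongrightarrow> L \<omega>"
    using lim L_eq by eventually_elim simp
  then have 2: "(\<lambda>m. \<integral>\<omega>. I (X (g m (J m \<omega>)) \<omega>) \<partial>C) \<longlonglongrightarrow> (\<integral>\<omega>. L \<omega> \<partial>C)"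
    by (intro integral_dominated_convergence[where w = "\<lambda>_. 1"]) auto
  have "AE \<omega> in C. (\<lambda>m. q (g m (J m \<omega>))) \<longlonglongrightarrow> q (Y t \<omega>)"
    using nonnegC 
    unfolding J_eq by eventually_elim (intro q_right gJ_lim gJ; simp)
  moreover have "\<bar>q (g m j)\<bar> \<le> 1" for m j
    using q[OF g0[of m j]] C.prob_le_1[unfolded C_def] by (metis abs_of_nonneg measure_nonneg)
  ultimately have 3: "(\<lambda>m. \<integral>\<omega>. q (g m (J m \<omega>)) \<partial>C) \<longlonglongrightarrow> (\<integral>\<omega>. q (Y t \<omega>) \<partial>C)"
    by (intro integral_dominated_convergence[where w = "\<lambda>_. 1"]) auto
  show ?thesis
    using LIMSEQ_unique[OF 2 3[folded grid]] 1 by (simp add: C_def)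
qed

section \<open>Inverse processes\<close>

text \<open>With \<open>inverse_process_ge\<close> this yields
  \<open>{u < E} \<subseteq> {D u \<le> x} \<subseteq> {u \<le> E}\<close>. A jump of
  \<open>D\<close> at \<open>u\<close> across the level \<open>x\<close> shows that the second
  inclusion can be strict.\<close>

lemma inverse_process_gt_D:
  assumes "0 \<le> u" "u < inverse_process D x \<omega>"
  shows "D u \<omega> \<le> x"
proof (rule ccontr)
  assume "\<not> D u \<omega> \<le> x"
  then have "inverse_process D x \<omega> \<le> u"
    unfolding inverse_process_def using assms(1)
    by (intro cInf_lower) (auto intro!: bdd_belowI[where m = 0])
  with assms(2) show False by simp
qed

text \<open>On the reals \<open>Inf {}\<close> carries no information, so the path has to exceed the
  level \<open>x\<close> somewhere.\<close>

lemma inverse_process_ge: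
  assumes "mono_on {0..} (\<lambda>r. D r \<omega>)" "\<exists>r\<ge>0. x < D r \<omega>" "0 \<le> u" "D u \<omega> \<le> x"
  shows "u \<le> inverse_process D x \<omega>"
  unfolding inverse_process_def
proof (rule cInf_greatest)
  show "{r. 0 \<le> r \<and> x < D r \<omega>} \<noteq> {}" using assms(2) by auto
  fix r assume r: "r \<in> {r. 0 \<le> r \<and> x < D r \<omega>}"
  show "u \<le> r"
  proof (rule ccontr)
    assume "\<not> u \<le> r"
    then have "D r \<omega> \<le> D u \<omega>"
      using r assms(3) by (intro mono_onD[OF assms(1)]) auto
    with r assms(4) show False by simp
  qed
qed

lemma inverse_process_nonneg:
  assumes "\<exists>r\<ge>0. x < D r \<omega>"
  shows "0 \<le> inverse_process D x \<omega>"
  unfolding inverse_process_def using assms by (intro cInf_greatest) auto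

lemma inverse_process_mono:
  assumes "\<And>x. \<exists>r\<ge>0. x < D r \<omega>" "x \<le> y"
  shows "inverse_process D x \<omega> \<le> inverse_process D y \<omega>"
  unfolding inverse_process_def
  by (rule cInf_superset_mono) (use assms in \<open>auto intro!: bdd_belowI[where m = 0]\<close>)

text \<open>An index \<open>r < a\<close> with \<open>x < D r \<omega>\<close> bounds the inverse at
  every level \<open>y < D r \<omega>\<close>, in particular at levels slightly above
  \<open>x\<close>. Monotonicity gives the estimate from below.\<close>

lemma continuous_at_right_inverse_process:
  assumes unb: "\<And>x. \<exists>r\<ge>0. x < D r \<omega>"
  shows "continuous (at_right x) (\<lambda>x. inverse_process D x \<omega>)"
  unfolding continuous_within
proof (rule order_tendstoI)
  fix a assume "a < inverse_process D x \<omega>"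
  then show "eventually (\<lambda>y. a < inverse_process D y \<omega>) (at_right x)"
    by (intro eventually_at_right_less[THEN eventually_mono])
      (meson inverse_process_mono[of D \<omega>, OF unb] less_imp_le less_le_trans)
next
  fix a assume "inverse_process D x \<omega> < a"
  then obtain r where r: "0 \<le> r" "x < D r \<omega>" "r < a"
    unfolding inverse_process_def using unb[of x]
    by (subst (asm) cInf_less_iff) (auto intro!: bdd_belowI[where m = 0])
  have "inverse_process D y \<omega> \<le> r" if "y < D r \<omega>" for y
    unfolding inverse_process_def using r that
    by (intro cInf_lower) (auto intro!: bdd_belowI[where m = 0])
  then have "inverse_process D y \<omega> < a" if "y < D r \<omega>" for y
    using r that by fastforce
  then show "eventually (\<lambda>y. inverse_process D y \<omega> < a) (at_right x)"
    using r(2) unfolding eventually_at_right_field by blast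
qed

text \<open>The inverse is nondecreasing and thus maps \<open>{x..}\<close> into
  \<open>{?E x..}\<close>. Closed half-lines are used because the inverse may be constant to the
  right of \<open>x\<close>.\<close>

lemma continuous_at_right_time_change_inverse:
  assumes unb: "\<And>x. \<exists>r\<ge>0. x < D r \<omega>"
    and X: "\<And>s. 0 \<le> s \<Longrightarrow> continuous (at_right s) (\<lambda>s. g (X s \<omega>))"
  shows "continuous (at_right x) (\<lambda>x. g (time_change X (inverse_process D) x \<omega>))"
proof -
  let ?E = "\<lambda>x. inverse_process D x \<omega>"
  have "continuous (at (?E x) within ?E ` {x..}) (\<lambda>s. g (X s \<omega>))"
  proof (rule continuous_within_subset)
    show "continuous (at (?E x) within {?E x..}) (\<lambda>s. g (X s \<omega>))"
      unfolding at_within_Ici_at_right by (rule X[OF inverse_process_nonneg[of _ D \<omega>, OF unb]])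
    show "?E ` {x..} \<subseteq> {?E x..}"
      using inverse_process_mono[of D \<omega>, OF unb] by auto
  qed
  moreover have "continuous (at x within {x..}) ?E"
    unfolding at_within_Ici_at_right by (rule continuous_at_right_inverse_process[of D \<omega>, OF unb])
  ultimately have "continuous (at x within {x..}) ((\<lambda>s. g (X s \<omega>)) \<circ> ?E)"
    by (rule continuous_within_compose[rotated])
  then show ?thesis
    unfolding at_within_Ici_at_right by (simp add: o_def time_change_def)
qed

section \<open>The stable subordinator and its inverse\<close>

lemma subordinator_measurable: "subordinator M f D \<Longrightarrow> 0 \<le> t \<Longrightarrow> D t \<in> borel_measurable M"
  and subordinator_mono: "subordinator M f D \<Longrightarrow> AE \<omega> in M. mono_on {0..} (\<lambda>t. D t \<omega>)"
  and subordinator_laplace: "subordinator M f D \<Longrightarrow> 0 \<le> t \<Longrightarrow> 0 < s \<Longrightarrow>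
    (\<integral>\<omega>. exp (- s * D t \<omega>) \<partial>M) = exp (- t * f s)"
  by (auto simp: subordinator_def levy_process_def)

lemma subordinator_nonneg:
  assumes "subordinator M f D" "0 \<le> t"
  shows "AE \<omega> in M. 0 \<le> D t \<omega>"
proof -
  have "AE \<omega> in M. D 0 \<omega> = 0" using assms by (simp add: subordinator_def levy_process_def)
  with subordinator_mono[OF assms(1)] show ?thesis
  proof eventually_elim
    case (elim \<omega>)
    then show ?case using mono_onD[OF elim(1), of 0 t] assms(2) by simp
  qed
qed

lemma (in prob_space) integrable_exp_nonpos:
  assumes [measurable]: "Z \<in> borel_measurable M" and "AE \<omega> in M. 0 \<le> Z \<omega>" "0 \<le> s"
  shows "integrable M (\<lambda>\<omega>. exp (- s * Z \<omega>) :: real)"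
  by (rule integrable_const_bound[where B = 1]) (use assms in auto)

text \<open>Exponential Markov inequality: \<open>exp (- s * D t)\<close> is at least
  \<open>exp (- s * K)\<close> on the event. Large \<open>t\<close> will give unboundedness of the
  paths, large \<open>s\<close> with \<open>K = 0\<close> positivity.\<close>

lemma (in prob_space) subordinator_chernoff:
  assumes sub: "subordinator M f D" and t: "0 \<le> t" and s: "0 < s"
  shows "prob {\<omega> \<in> space M. D t \<omega> \<le> K} \<le> exp (s * K - t * f s)"
proof -
  note [measurable] = subordinator_measurable[OF sub t]
  have "prob {\<omega> \<in> space M. D t \<omega> \<le> K} * exp (- s * K) 
      = (\<integral>\<omega>. indicator {\<omega> \<in> space M. D t \<omega> \<le> K} \<omega> * exp (- s * K) \<partial>M)"
    by simp
  also have "\<dots> \<le> (\<integral>\<omega>. exp (- s * D t \<omega>) \<partial>M)"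
    using s by (intro integral_mono integrable_exp_nonpos subordinator_nonneg[OF sub t])
      (auto split: split_indicator simp: emeasure_eq_measure intro!: integrable_real_mult_indicator)
  also have "\<dots> = exp (- t * f s)" by (rule subordinator_laplace[OF sub t s])
  finally show ?thesis
    by (simp add: exp_diff exp_minus field_simps)
qed

text \<open>At \<open>s = 1\<close> the Chernoff bound for \<open>D k \<le> K\<close> is
  \<open>exp (K - k)\<close>, so staying below \<open>K\<close> at all integer times has probability
  0. This keeps the sets defining the inverse process nonempty.\<close>

lemma (in prob_space) stable_unbounded:
  assumes sub: "subordinator M (\<lambda>s. s powr \<beta>) D"
  shows "AE \<omega> in M. \<forall>x. \<exists>r\<ge>0. x < D r \<omega>"
proof -
  note [measurable] = subordinator_measurable[OF sub]
  have "AE \<omega> in M. \<exists>k::nat. real K < D (real k) \<omega>" for K :: nat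
  proof -
    have "prob {\<omega> \<in> space M. \<forall>k::nat. D (real k) \<omega> \<le> K} \<le> exp (real K - real k)" for k
    proof -
      have "prob {\<omega> \<in> space M. \<forall>k::nat. D (real k) \<omega> \<le> K} \<le> prob {\<omega> \<in> space M. D (real k) \<omega> \<le> K}"
        by (rule finite_measure_mono) auto
      also have "\<dots> \<le> exp (real K - real k)"
        using subordinator_chernoff[OF sub, of "real k" 1 K] by simp
      finally show ?thesis .
    qed
    moreover have "(\<lambda>k. exp (real K - real k)) \<longlonglongrightarrow> 0" by real_asymp
    ultimately have "prob {\<omega> \<in> space M. \<forall>k::nat. D (real k) \<omega> \<le> K} \<le> 0"
      by (intro LIMSEQ_le_const) auto
    then have "prob {\<omega> \<in> space M. \<forall>k::nat. D (real k) \<omega> \<le> K} = 0"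
      using measure_nonneg[of M] by (intro antisym) auto
    then have "AE \<omega> in M. \<omega> \<notin> {\<omega> \<in> space M. \<forall>k::nat. D (real k) \<omega> \<le> K}"
      by (intro prob_eq_0[THEN iffD1]) auto
    then show ?thesis using AE_space by eventually_elim (auto simp: not_le)
  qed
  then have "AE \<omega> in M. \<forall>K. \<exists>k::nat. real K < D (real k) \<omega>"
    unfolding AE_all_countable by blast
  then show ?thesis
  proof eventually_elim
    case (elim \<omega>)
    show ?case
    proof
      fix x
      obtain K where "x < real K" using reals_Archimedean2 by blast
      moreover obtain k :: nat where "real K < D (real k) \<omega>" using elim by blast
      ultimately show "\<exists>r\<ge>0. x < D r \<omega>" by (intro exI[of _ "real k"]) auto
    qed
  qed
qed

lemma (in prob_space) stable_positive:
  assumes sub: "subordinator M (\<lambda>s. s powr \<beta>) D" and "0 < \<beta>"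
  shows "AE \<omega> in M. 0 < D 1 \<omega>"
proof -
  note [measurable] = subordinator_measurable[OF sub]
  have "prob {\<omega> \<in> space M. D 1 \<omega> \<le> 0} \<le> exp (- real (Suc k))" for k
    \<comment> \<open>The choice \<open>s = Suc k powr (1 / \<beta>)\<close> makes
      \<open>s powr \<beta>\<close> equal to \<open>Suc k\<close>.\<close>
    using subordinator_chernoff[OF sub, of 1 "real (Suc k) powr (1 / \<beta>)" 0] assms(2)
    by (simp add: powr_powr)
  moreover have "(\<lambda>k. exp (- real (Suc k))) \<longlonglongrightarrow> 0" by real_asymp
  ultimately have "prob {\<omega> \<in> space M. D 1 \<omega> \<le> 0} \<le> 0"
    by (intro LIMSEQ_le_const) auto
  then have "prob {\<omega> \<in> space M. D 1 \<omega> \<le> 0} = 0"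
    using measure_nonneg[of M] by (intro antisym) auto
  then have "AE \<omega> in M. \<omega> \<notin> {\<omega> \<in> space M. D 1 \<omega> \<le> 0}"
    by (intro prob_eq_0[THEN iffD1]) auto
  then show ?thesis using AE_space by eventually_elim (auto simp: not_le)
qed

text \<open>Both variables have the Laplace transform
  \<open>exp (- u * s powr \<beta>)\<close>.\<close>

lemma (in prob_space) stable_scaling:
  assumes sub: "subordinator M (\<lambda>s. s powr \<beta>) D" and \<beta>: "0 < \<beta>" and u: "0 < u"
  shows "distr M borel (D u) = distr M borel (\<lambda>\<omega>. u powr (1 / \<beta>) * D 1 \<omega>)"
proof -
  have [measurable]: "D u \<in> borel_measurable M" "D 1 \<in> borel_measurable M"
    using subordinator_measurable[OF sub] u by auto
  show ?thesis
  proof (rule laplace_unique)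
    show "AE x in distr M borel (D u). 0 \<le> x"
      using subordinator_nonneg[OF sub, of u] u by (simp add: AE_distr_iff)
    show "AE x in distr M borel (\<lambda>\<omega>. u powr (1 / \<beta>) * D 1 \<omega>). 0 \<le> x"
      using subordinator_nonneg[OF sub, of 1] u by (simp add: AE_distr_iff zero_le_mult_iff)
    fix s :: real assume s: "0 < s"
    have "(\<integral>\<omega>. exp (- (s * u powr (1 / \<beta>)) * D 1 \<omega>) \<partial>M) = exp (- u * s powr \<beta>)"
      using subordinator_laplace[OF sub, of 1 "s * u powr (1 / \<beta>)"] s u \<beta>
      by (simp add: powr_mult powr_powr mult.commute)
    then show "(\<integral>x. exp (- s * x) \<partial>distr M borel (D u)) =
        (\<integral>x. exp (- s * x) \<partial>distr M borel (\<lambda>\<omega>. u powr (1 / \<beta>) * D 1 \<omega>))"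
      using subordinator_laplace[OF sub, of u s] s u
      by (simp add: integral_distr mult.assoc)
  qed (auto intro!: real_distribution_distr)
qed

text \<open>For \<open>d = 0\<close> the convention \<open>0 powr (- \<beta>) = 0\<close> would make
  the left side false and the right side true. This is why \<open>D 1\<close> must be almost surely
  positive.\<close>

lemma le_powr_quotient_iff:
  fixes u x d \<beta> :: real
  assumes "0 < u" "0 \<le> x" "0 < d" "0 < \<beta>"
  shows "u \<le> x powr \<beta> * d powr (- \<beta>) \<longleftrightarrow> u powr (1 / \<beta>) * d \<le> x"
proof -
  have e: "x powr \<beta> * d powr (- \<beta>) = (x / d) powr \<beta>"
    using assms by (simp add: powr_divide powr_minus field_simps)
  have "(u powr (1 / \<beta>)) powr \<beta> = u" using assms by (simp add: powr_powr)
  then have "u \<le> (x / d) powr \<beta> \<longleftrightarrow> (u powr (1 / \<beta>)) powr \<beta> \<le> (x / d) powr \<beta>" by simp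
  also have "\<dots> \<longleftrightarrow> u powr (1 / \<beta>) \<le> x / d"
  proof
    assume *: "(u powr (1 / \<beta>)) powr \<beta> \<le> (x / d) powr \<beta>"
    show "u powr (1 / \<beta>) \<le> x / d"
    proof (rule ccontr)
      assume "\<not> u powr (1 / \<beta>) \<le> x / d"
      with powr_less_mono2[of \<beta> "x / d" "u powr (1 / \<beta>)"] assms * show False by simp
    qed
  qed (use assms in \<open>auto intro!: powr_mono2\<close>)
  also have "\<dots> \<longleftrightarrow> u powr (1 / \<beta>) * d \<le> x" using assms by (simp add: field_simps)
  finally show ?thesis by (simp add: e)
qed

lemma (in real_distribution) cdf_right_limit_ge:
  assumes "\<And>v. u < v \<Longrightarrow> a \<le> cdf M v"
  shows "a \<le> cdf M u"
proof (rule tendsto_lowerbound)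
  show "(cdf M \<longlongrightarrow> cdf M u) (at_right u)"
    using cdf_is_right_cont[of u] by (simp add: continuous_within)
  show "eventually (\<lambda>v. a \<le> cdf M v) (at_right u)"
    using eventually_at_right_less[of u] by eventually_elim (rule assms)
qed simp

lemma (in prob_space) cdf_distr_eq:
  assumes "Z \<in> borel_measurable M"
  shows "cdf (distr M borel Z) u = prob {\<omega> \<in> space M. Z \<omega> \<le> u}"
  unfolding cdf_def using assms by (subst measure_distr) (auto intro!: arg_cong[where f = prob])

text \<open>Up to boundary cases \<open>{E x > u}\<close> is \<open>{D u \<le> x}\<close>, whose probability is that of
  \<open>{u powr (1 / \<beta>) * D 1 \<le> x}\<close>; the distribution functions are therefore sandwiched and agree by
  right-continuity.\<close>

lemma (in prob_space) inverse_stable_distribution: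
  assumes sub: "subordinator M (\<lambda>s. s powr \<beta>) D" and \<beta>: "0 < \<beta>" and x: "0 \<le> x"
    and E_meas: "inverse_process D x \<in> borel_measurable (completion M)"
  shows "distr (completion M) borel (inverse_process D x) =
    distr (completion M) borel (\<lambda>\<omega>. x powr \<beta> * D 1 \<omega> powr (- \<beta>))"
proof -
  define C where "C = completion M"
  have spC: "space C = space M" by (simp add: C_def)
  interpret C: prob_space C
    unfolding C_def by (intro prob_spaceI) (simp add: emeasure_space_1)
  define E where "E = inverse_process D x"
  define W where "W \<omega> = x powr \<beta> * D 1 \<omega> powr (- \<beta>)" for \<omega>
  have [measurable]: "E \<in> borel_measurable C" using E_meas by (simp add: E_def C_def)
  have DM[measurable]: "D u \<in> borel_measurable M" if "0 \<le> u" for u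
    using subordinator_measurable[OF sub] that by auto
  have WM[measurable]: "W \<in> borel_measurable M"
    using DM[of 1] unfolding W_def[abs_def] by measurable
  have WC[measurable]: "W \<in> borel_measurable C"
    using measurable_completion[OF WM] by (simp add: C_def)
  have compl: "C.prob {\<omega> \<in> space M. Q \<omega>} = 1 - C.prob {\<omega> \<in> space M. \<not> Q \<omega>}"
    if "{\<omega> \<in> space M. Q \<omega>} \<in> sets C" for Q
    using C.prob_neg[of Q] that by (simp add: spC)
  have PW: "C.prob {\<omega> \<in> space M. u \<le> W \<omega>} = prob {\<omega> \<in> space M. D u \<omega> \<le> x}" if u: "0 < u" for u
  proof -
    have [measurable]: "D u \<in> borel_measurable M" "D 1 \<in> borel_measurable M" using DM u by auto
    have "C.prob {\<omega> \<in> space M. u \<le> W \<omega>} = prob {\<omega> \<in> space M. u \<le> W \<omega>}"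
      unfolding C_def by (rule measure_completion) measurable
    also have "\<dots> = prob {\<omega> \<in> space M. u powr (1 / \<beta>) * D 1 \<omega> \<le> x}"
      using stable_positive[OF sub \<beta>]
      by (intro finite_measure_eq_AE) (auto simp: W_def le_powr_quotient_iff[OF u x _ \<beta>])
    also have "\<dots> = measure (distr M borel (\<lambda>\<omega>. u powr (1 / \<beta>) * D 1 \<omega>)) {..x}"
      by (subst measure_distr) (auto intro!: arg_cong[where f = prob])
    also have "\<dots> = prob {\<omega> \<in> space M. D u \<omega> \<le> x}"
      unfolding stable_scaling[OF sub \<beta> u, symmetric]
      by (subst measure_distr) (auto intro!: arg_cong[where f = prob])
    finally show ?thesis .
  qed
  have DuC: "C.prob {\<omega> \<in> space M. D u \<omega> \<le> x} = prob {\<omega> \<in> space M. D u \<omega> \<le> x}"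
    and DuS: "{\<omega> \<in> space M. D u \<omega> \<le> x} \<in> sets C" if u: "0 < u" for u
  proof -
    have [measurable]: "D u \<in> borel_measurable M" using DM u by auto
    have "{\<omega> \<in> space M. D u \<omega> \<le> x} \<in> sets M" by measurable
    then show "C.prob {\<omega> \<in> space M. D u \<omega> \<le> x} = prob {\<omega> \<in> space M. D u \<omega> \<le> x}"
      "{\<omega> \<in> space M. D u \<omega> \<le> x} \<in> sets C" unfolding C_def by auto
  qed
  have up: "C.prob {\<omega> \<in> space M. u < E \<omega>} \<le> C.prob {\<omega> \<in> space M. u \<le> W \<omega>}" if u: "0 < u" for u
    unfolding PW[OF u] DuC[OF u, symmetric] using u
    by (intro C.finite_measure_mono DuS) (auto simp: E_def intro: inverse_process_gt_D)
  have low: "C.prob {\<omega> \<in> space M. u \<le> W \<omega>} \<le> C.prob {\<omega> \<in> space M. u \<le> E \<omega>}" if u: "0 < u" for u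
    unfolding PW[OF u] DuC[OF u, symmetric]
  proof (rule C.finite_measure_mono_AE)
    have "AE \<omega> in M. D u \<omega> \<le> x \<longrightarrow> u \<le> E \<omega>"
      using subordinator_mono[OF sub] stable_unbounded[OF sub]
      by eventually_elim (use u in \<open>auto simp: E_def intro!: inverse_process_ge\<close>)
    then show "AE \<omega> in C. \<omega> \<in> {\<omega> \<in> space M. D u \<omega> \<le> x} \<longrightarrow> \<omega> \<in> {\<omega> \<in> space M. u \<le> E \<omega>}"
      unfolding C_def by (rule AE_completion[THEN eventually_mono]) auto
    have "{\<omega> \<in> space C. u \<le> E \<omega>} \<in> sets C" by measurable
    then show "{\<omega> \<in> space M. u \<le> E \<omega>} \<in> sets C" by (simp add: spC)
  qed
  let ?A = "distr C borel E" and ?B = "distr C borel W"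
  interpret A: real_distribution ?A by (rule C.real_distribution_distr) measurable
  interpret B: real_distribution ?B by (rule C.real_distribution_distr) measurable
  have sets_C: "{\<omega> \<in> space M. E \<omega> \<le> u} \<in> sets C" "{\<omega> \<in> space M. E \<omega> < u} \<in> sets C"
    "{\<omega> \<in> space M. W \<omega> \<le> u} \<in> sets C" "{\<omega> \<in> space M. W \<omega> < u} \<in> sets C" for u
    unfolding spC[symmetric] by measurable
  have cA: "cdf ?A u = C.prob {\<omega> \<in> space M. E \<omega> \<le> u}" for u
    by (subst C.cdf_distr_eq) (auto simp: spC)
  have cB: "cdf ?B u = C.prob {\<omega> \<in> space M. W \<omega> \<le> u}" for u
    by (subst C.cdf_distr_eq) (auto simp: spC)
  \<comment> \<open>The gap between \<open>u\<close> and \<open>v\<close> turns weak into strict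
    inequalities, after which the inclusions apply through complements.\<close>
  have AB: "cdf ?A u \<le> cdf ?B v" if "u < v" "0 < v" for u v
  proof -
    have "cdf ?A u \<le> C.prob {\<omega> \<in> space M. E \<omega> < v}"
      unfolding cA using that by (intro C.finite_measure_mono sets_C) auto
    also have "\<dots> \<le> C.prob {\<omega> \<in> space M. W \<omega> < v}"
      using low[OF that(2)] sets_C by (subst (1 2) compl) (auto simp: not_less)
    also have "\<dots> \<le> cdf ?B v"
      unfolding cB by (intro C.finite_measure_mono sets_C) auto
    finally show ?thesis .
  qed
  have BA: "cdf ?B u \<le> cdf ?A v" if "u < v" "0 < v" for u v
  proof -
    have "cdf ?B u \<le> C.prob {\<omega> \<in> space M. W \<omega> < v}"
      unfolding cB using that by (intro C.finite_measure_mono sets_C) auto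
    also have "\<dots> \<le> cdf ?A v"
      unfolding cA using up[OF that(2)] sets_C by (subst (1 2) compl) (auto simp: not_less not_le)
    finally show ?thesis .
  qed
  have "cdf ?A u = cdf ?B u" for u
  proof (cases "0 \<le> u")
    case True
    have "cdf ?A u \<le> cdf ?B u" by (rule B.cdf_right_limit_ge, rule AB) (use True in auto)
    moreover have "cdf ?B u \<le> cdf ?A u" by (rule A.cdf_right_limit_ge, rule BA) (use True in auto)
    ultimately show ?thesis by (rule antisym)
  next
    case False
    \<comment> \<open>The sandwich holds at positive levels only; below 0 both distribution
      functions vanish because both variables are almost surely nonnegative.\<close>
    have "AE \<omega> in M. 0 \<le> E \<omega>"
      using stable_unbounded[OF sub] by eventually_elim (auto simp: E_def intro!: inverse_process_nonneg)
    then have "AE \<omega> in C. 0 \<le> E \<omega>" unfolding C_def by (rule AE_completion)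
    then have "C.prob {\<omega> \<in> space M. E \<omega> \<le> u} = C.prob {}"
      using False sets_C by (intro C.finite_measure_eq_AE) auto
    moreover have "C.prob {\<omega> \<in> space M. W \<omega> \<le> u} = C.prob {}"
    proof (rule arg_cong[where f = C.prob])
      have "0 \<le> W \<omega>" for \<omega> by (simp add: W_def)
      then show "{\<omega> \<in> space M. W \<omega> \<le> u} = {}" using False by (auto simp: not_le intro: less_le_trans)
    qed
    ultimately show ?thesis unfolding cA cB by simp
  qed
  then have "cdf ?A = cdf ?B" ..
  then have "?A = ?B"
    by (intro cdf_unique) unfold_locales
  then show ?thesis by (simp add: C_def E_def W_def[abs_def])
qed

text \<open>Substitution \<open>t = c * s\<close> in Euler's integral. The form with
  \<open>nn_integral\<close> is what Tonelli's theorem takes when \<open>c\<close> becomes the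
  random value \<open>D 1 \<omega>\<close>.\<close>

lemma nn_integral_gamma_scaled:
  fixes a c :: real
  assumes "0 < a" "0 < c"
  shows "(\<integral>\<^sup>+s. ennreal (indicator {0..} s * s powr (a - 1) * exp (- s * c)) \<partial>lborel)
    = ennreal (Gamma a * c powr (- a))"
proof -
  have "ennreal (Gamma a) = (\<integral>\<^sup>+t. ennreal (indicator {0..} t * t powr (a - 1) / exp t) \<partial>lborel)"
    using assms by (intro Gamma_conv_nn_integral_real) auto
  also have "\<dots> = ennreal \<bar>c\<bar> * (\<integral>\<^sup>+s. ennreal (indicator {0..} (0 + c * s) * (0 + c * s) powr (a - 1) / exp (0 + c * s)) \<partial>lborel)"
    using assms by (intro nn_integral_real_affine) auto
  also have "\<dots> = (\<integral>\<^sup>+s. ennreal (c powr a) * ennreal (indicator {0..} s * s powr (a - 1) * exp (- s * c)) \<partial>lborel)"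
    using assms
    by (subst nn_integral_cmult[symmetric])
      (auto intro!: nn_integral_cong simp: ennreal_mult'[symmetric] powr_mult powr_diff exp_minus field_simps
         zero_le_mult_iff split: split_indicator)
  also have "\<dots> = ennreal (c powr a) * (\<integral>\<^sup>+s. ennreal (indicator {0..} s * s powr (a - 1) * exp (- s * c)) \<partial>lborel)"
    by (intro nn_integral_cmult) auto
  finally have "ennreal (c powr (- a)) * ennreal (Gamma a) = ennreal (c powr (- a)) * ennreal (c powr a) *
      (\<integral>\<^sup>+s. ennreal (indicator {0..} s * s powr (a - 1) * exp (- s * c)) \<partial>lborel)"
    by (simp add: mult.assoc)
  moreover have "ennreal (c powr (- a)) * ennreal (c powr a) = 1"
    using assms by (simp add: ennreal_mult'[symmetric] powr_add[symmetric])
  ultimately have "(\<integral>\<^sup>+s. ennreal (indicator {0..} s * s powr (a - 1) * exp (- s * c)) \<partial>lborel)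
      = ennreal (c powr (- a)) * ennreal (Gamma a)"
    by simp
  also have "\<dots> = ennreal (c powr (- a) * Gamma a)"
    by (rule ennreal_mult'[symmetric]) simp
  finally show ?thesis by (simp only: mult.commute[of "Gamma a"])
qed

text \<open>Writing \<open>exp (- (s powr \<beta>))\<close> as the integral of \<open>exp (- v)\<close> over \<open>v \<ge> s powr \<beta>\<close> avoids a nonlinear
  substitution.\<close>

lemma nn_integral_powr_exp_powr:
  fixes \<beta> :: real and m :: nat
  assumes \<beta>: "0 < \<beta>" and m: "0 < m"
  shows "(\<integral>\<^sup>+s. ennreal (indicator {0..} s * s powr (\<beta> * m - 1) * exp (- (s powr \<beta>))) \<partial>lborel)
    = ennreal (fact m / (\<beta> * m))"
proof -
  define a where "a = \<beta> * m"
  have a: "0 < a" using assms by (simp add: a_def)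
  have tail: "ennreal (exp (- c)) = (\<integral>\<^sup>+v. ennreal (indicator {c..} v * exp (- v)) \<partial>lborel)" for c :: real
  proof -
    have "((\<lambda>t. exp (- 1 * t)) has_integral exp (- 1 * c) / 1) {c..}"
      by (intro has_integral_exp_minus_to_infinity) auto
    from nn_integral_has_integral_lebesgue[OF _ this] show ?thesis by simp
  qed
  have power: "(\<integral>\<^sup>+s. ennreal (indicator {0..c} s * s powr (a - 1)) \<partial>lborel) = ennreal (c powr a / a)"
    if "0 \<le> c" for c
  proof -
    have "((\<lambda>s. s powr (a - 1)) has_integral c powr (a - 1 + 1) / (a - 1 + 1)) {0..c}"
      using that a by (intro has_integral_powr_from_0) auto
    from nn_integral_has_integral_lebesgue[OF _ this] show ?thesis by simp
  qed
  have iff: "s powr \<beta> \<le> v \<longleftrightarrow> 0 \<le> v \<and> s \<le> v powr (1 / \<beta>)" if s: "0 \<le> s" for s v :: real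
  proof (cases "0 \<le> v")
    case True
    have 1: "(s powr \<beta>) powr (1 / \<beta>) = s" "(v powr (1 / \<beta>)) powr \<beta> = v"
      using s True \<beta> by (simp_all add: powr_powr)
    show ?thesis
      using powr_mono2[of "1 / \<beta>" "s powr \<beta>" v] powr_mono2[of \<beta> s "v powr (1 / \<beta>)"] 1 s True \<beta> by auto
  next
    case False
    then show ?thesis using powr_ge_zero[of s \<beta>] by linarith
  qed
  let ?g = "\<lambda>s v. indicator {0..} s * indicator {s powr \<beta>..} v * s powr (a - 1) * exp (- v) :: real"
  have "(\<integral>\<^sup>+s. ennreal (indicator {0..} s * s powr (a - 1) * exp (- (s powr \<beta>))) \<partial>lborel)
      = (\<integral>\<^sup>+s. \<integral>\<^sup>+v. ennreal (?g s v) \<partial>lborel \<partial>lborel)"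
  proof (rule nn_integral_cong)
    fix s :: real
    have "ennreal (indicator {0..} s * s powr (a - 1) * exp (- (s powr \<beta>)))
        = (\<integral>\<^sup>+v. ennreal (indicator {0..} s * s powr (a - 1)) * ennreal (indicator {s powr \<beta>..} v * exp (- v)) \<partial>lborel)"
    proof -
      have "ennreal (indicator {0..} s * s powr (a - 1) * exp (- (s powr \<beta>)))
          = ennreal (indicator {0..} s * s powr (a - 1)) * ennreal (exp (- (s powr \<beta>)))"
        by (rule ennreal_mult'') simp
      also have "\<dots> = ennreal (indicator {0..} s * s powr (a - 1)) *
          (\<integral>\<^sup>+v. ennreal (indicator {s powr \<beta>..} v * exp (- v)) \<partial>lborel)"
        by (simp only: tail)
      finally show ?thesis
        by (subst nn_integral_cmult) auto
    qed
    also have "\<dots> = (\<integral>\<^sup>+v. ennreal (?g s v) \<partial>lborel)"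
      by (intro nn_integral_cong) (auto simp: ennreal_mult''[symmetric] split: split_indicator)
    finally show "ennreal (indicator {0..} s * s powr (a - 1) * exp (- (s powr \<beta>))) = (\<integral>\<^sup>+v. ennreal (?g s v) \<partial>lborel)" .
  qed
  also have "\<dots> = (\<integral>\<^sup>+v. \<integral>\<^sup>+s. ennreal (?g s v) \<partial>lborel \<partial>lborel)"
    by (rule lborel_pair.Fubini') (simp add: indicator_def, measurable)
  \<comment> \<open>After the swap \<open>s\<close> ranges over
    \<open>{0..v powr (1 / \<beta>)}\<close>, which contributes \<open>v ^ m / a\<close> because
    \<open>a / \<beta> = m\<close>. The exponent is written \<open>m + 1 - 1\<close> to match the
    integral for \<open>Gamma (m + 1)\<close>.\<close>
  also have "\<dots> = (\<integral>\<^sup>+v. ennreal (1 / a) * ennreal (indicator {0..} v * v powr (real m + 1 - 1) / exp v) \<partial>lborel)"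
  proof (rule nn_integral_cong)
    fix v :: real
    have "(\<integral>\<^sup>+s. ennreal (?g s v) \<partial>lborel) = (\<integral>\<^sup>+s. ennreal (indicator {0..} v * exp (- v)) *
        ennreal (indicator {0..v powr (1 / \<beta>)} s * s powr (a - 1)) \<partial>lborel)"
      using iff by (intro nn_integral_cong) (auto simp: ennreal_mult''[symmetric] split: split_indicator)
    also have "\<dots> = ennreal (indicator {0..} v * exp (- v)) * ennreal ((v powr (1 / \<beta>)) powr a / a)"
      by (subst nn_integral_cmult) (auto simp: power)
    also have "\<dots> = ennreal (1 / a) * ennreal (indicator {0..} v * v powr (real m + 1 - 1) / exp v)"
      using a \<beta> by (auto simp: ennreal_mult'[symmetric] powr_powr a_def exp_minus field_simps split: split_indicator)
    finally show "(\<integral>\<^sup>+s. ennreal (?g s v) \<partial>lborel) =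
      ennreal (1 / a) * ennreal (indicator {0..} v * v powr (real m + 1 - 1) / exp v)" .
  qed
  also have "\<dots> = ennreal (1 / a) * ennreal (Gamma (real m + 1))"
    by (subst nn_integral_cmult) (auto simp: Gamma_conv_nn_integral_real[of "real m + 1"])
  also have "\<dots> = ennreal (fact m / a)"
    using a Gamma_fact[of m, where 'a = real] by (simp add: ennreal_mult'[symmetric] add.commute)
  finally show ?thesis by (simp add: a_def)
qed

text \<open>\<open>D 1 powr (- a)\<close> is a Gamma integral of \<open>exp (- s * D 1)\<close> over \<open>s\<close>, so only the Laplace
  transform of \<open>D 1\<close> enters.\<close>

lemma (in prob_space) stable_negative_moments:
  assumes sub: "subordinator M (\<lambda>s. s powr \<beta>) D" and \<beta>: "0 < \<beta>"
  shows "integrable M (\<lambda>\<omega>. (D 1 \<omega> powr (- \<beta>)) ^ m)"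
    and "(\<integral>\<omega>. (D 1 \<omega> powr (- \<beta>)) ^ m \<partial>M) = fact m / Gamma (\<beta> * real m + 1)"
proof -
  have [measurable]: "D 1 \<in> borel_measurable M" using subordinator_measurable[OF sub] by auto
  have pos: "AE \<omega> in M. 0 < D 1 \<omega>" by (rule stable_positive[OF sub \<beta>])
  have nn: "(\<integral>\<^sup>+\<omega>. ennreal ((D 1 \<omega> powr (- \<beta>)) ^ m) \<partial>M) = ennreal (fact m / Gamma (\<beta> * real m + 1))"
  proof (cases "m = 0")
    case True
    then show ?thesis by (simp add: emeasure_space_1)
  next
    case False
    \<comment> \<open>The Gamma integral diverges at \<open>a = 0\<close>, hence the separate case
      \<open>m = 0\<close>.\<close>
    define a where "a = \<beta> * m"
    have a: "0 < a" using False \<beta> by (simp add: a_def)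
    have Ga: "0 < Gamma a" using a by (rule Gamma_real_pos)
    let ?g = "\<lambda>s \<omega>. indicator {0..} s * s powr (a - 1) * exp (- s * D 1 \<omega>)"
    interpret L: pair_sigma_finite lborel M ..
    have "ennreal (Gamma a) * (\<integral>\<^sup>+\<omega>. ennreal ((D 1 \<omega> powr (- \<beta>)) ^ m) \<partial>M)
        = (\<integral>\<^sup>+\<omega>. ennreal (Gamma a) * ennreal ((D 1 \<omega> powr (- \<beta>)) ^ m) \<partial>M)"
      by (rule nn_integral_cmult[symmetric]) measurable
    also have "\<dots> = (\<integral>\<^sup>+\<omega>. (\<integral>\<^sup>+s. ennreal (?g s \<omega>) \<partial>lborel) \<partial>M)"
    proof (rule nn_integral_cong_AE, use pos in eventually_elim)
      case (elim \<omega>)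
      have "(D 1 \<omega> powr (- \<beta>)) ^ m = D 1 \<omega> powr (- a)"
        using elim by (simp add: a_def powr_power mult.commute)
      then show ?case
        using nn_integral_gamma_scaled[OF a elim] Ga by (simp add: ennreal_mult')
    qed
    also have "\<dots> = (\<integral>\<^sup>+s. (\<integral>\<^sup>+\<omega>. ennreal (?g s \<omega>) \<partial>M) \<partial>lborel)"
      by (rule L.Fubini') measurable
    also have "\<dots> = (\<integral>\<^sup>+s. ennreal (indicator {0..} s * s powr (a - 1) * exp (- (s powr \<beta>))) \<partial>lborel)"
    proof (rule nn_integral_cong_AE, rule AE_I2)
      fix s :: real
      show "(\<integral>\<^sup>+\<omega>. ennreal (?g s \<omega>) \<partial>M) = ennreal (indicator {0..} s * s powr (a - 1) * exp (- (s powr \<beta>)))"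
      proof (cases "0 < s")
        case True
        have "(\<integral>\<^sup>+\<omega>. ennreal (exp (- s * D 1 \<omega>)) \<partial>M) = ennreal (\<integral>\<omega>. exp (- s * D 1 \<omega>) \<partial>M)"
          using True subordinator_nonneg[OF sub, of 1]
          by (intro nn_integral_eq_integral integrable_exp_nonpos) auto
        also have "\<dots> = ennreal (exp (- (s powr \<beta>)))"
          using subordinator_laplace[OF sub, of 1 s] True by simp
        finally have 1: "(\<integral>\<^sup>+\<omega>. ennreal (exp (- s * D 1 \<omega>)) \<partial>M) = ennreal (exp (- (s powr \<beta>)))" .
        have "(\<integral>\<^sup>+\<omega>. ennreal (?g s \<omega>) \<partial>M) = (\<integral>\<^sup>+\<omega>. ennreal (s powr (a - 1)) * ennreal (exp (- s * D 1 \<omega>)) \<partial>M)"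
          using True by (intro nn_integral_cong) (simp add: ennreal_mult')
        also have "\<dots> = ennreal (s powr (a - 1)) * (\<integral>\<^sup>+\<omega>. ennreal (exp (- s * D 1 \<omega>)) \<partial>M)"
          by (rule nn_integral_cmult) measurable
        finally show ?thesis using True by (simp only: 1) (simp add: ennreal_mult')
      next
        case False
        \<comment> \<open>At \<open>s = 0\<close> both sides vanish since
          \<open>0 powr (a - 1) = 0\<close>, for negative \<open>s\<close> by the indicator.\<close>
        then show ?thesis by (cases "s = 0") auto
      qed
    qed
    also have "\<dots> = ennreal (fact m / a)"
      unfolding a_def using False \<beta> by (intro nn_integral_powr_exp_powr) auto
    finally have "ennreal (1 / Gamma a) * ennreal (Gamma a) * (\<integral>\<^sup>+\<omega>. ennreal ((D 1 \<omega> powr (- \<beta>)) ^ m) \<partial>M)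
        = ennreal (1 / Gamma a) * ennreal (fact m / a)"
      by (simp add: mult.assoc)
    moreover have "ennreal (1 / Gamma a) * ennreal (Gamma a) = 1"
      using Ga by (simp add: ennreal_mult'[symmetric])
    moreover have "1 / Gamma a * (fact m / a) = fact m / Gamma (a + 1)"
      using a Gamma_plus1[of a] by (auto simp: nonpos_Ints_def)
    ultimately show ?thesis
      using Ga by (simp add: ennreal_mult'[symmetric] a_def)
  qed
  show "integrable M (\<lambda>\<omega>. (D 1 \<omega> powr (- \<beta>)) ^ m)"
    by (rule integrableI_nonneg) (use nn in auto)
  have "0 \<le> fact m / Gamma (\<beta> * real m + 1)"
    using \<beta> Gamma_real_pos[of "\<beta> * real m + 1"] by (simp add: add_nonneg_pos)
  then show "(\<integral>\<omega>. (D 1 \<omega> powr (- \<beta>)) ^ m \<partial>M) = fact m / Gamma (\<beta> * real m + 1)"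
    by (subst integral_eq_nn_integral) (use nn in auto)
qed

section \<open>Mittag-Leffler mixtures of Poisson probabilities\<close>

lemma summable_mittag_leffler:
  fixes \<beta> z :: real
  assumes \<beta>: "0 < \<beta>" and z: "0 \<le> z"
  shows "summable (\<lambda>m. z ^ m / Gamma (\<beta> * real m + 1))"
proof -
  \<comment> \<open>With this \<open>a\<close> the Gamma bound grows like
    \<open>(2 * (z + 1)) ^ m\<close>, leaving a geometric series of ratio 1/2. The shift to
    \<open>z + 1\<close> keeps \<open>a\<close> positive at \<open>z = 0\<close>.\<close>
  define a where "a = (2 * (z + 1)) powr (1 / \<beta>)"
  have a: "0 < a" using z by (simp add: a_def)
  have G: "0 < Gamma (\<beta> * real m + 1)" for m
    using \<beta> by (intro Gamma_real_pos) (simp add: add_nonneg_pos)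
  show ?thesis
  proof (rule summable_comparison_test')
    show "summable (\<lambda>m. exp a * (1 / 2) ^ m :: real)"
      by (intro summable_mult summable_geometric) simp
    fix m :: nat
    have "a powr (\<beta> * real m) = (2 * (z + 1)) ^ m"
      using z \<beta> by (simp add: a_def powr_powr powr_realpow)
    then have "(2 * (z + 1)) ^ m * exp (- a) \<le> Gamma (\<beta> * real m + 1)"
      using Gamma_lower_bound[OF a, of "\<beta> * real m"] \<beta> by simp
    then have "(2 * (z + 1)) ^ m \<le> exp a * Gamma (\<beta> * real m + 1)"
      by (simp add: exp_minus field_simps)
    moreover have "(2 * z) ^ m \<le> (2 * (z + 1)) ^ m"
      using z by (intro power_mono) auto
    ultimately have "(2 * z) ^ m \<le> exp a * Gamma (\<beta> * real m + 1)" by linarith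
    then show "norm (z ^ m / Gamma (\<beta> * real m + 1)) \<le> exp a * (1 / 2) ^ m"
      using z G[of m] by (simp add: power_divide power_mult_distrib field_simps)
  qed
qed

text \<open>The quotient is \<open>n!\<close> times a binomial coefficient, so it costs only a
  geometric factor.\<close>

lemma fact_ratio_le: "fact (n + k) / fact k \<le> (fact n * 2 ^ (n + k) :: real)"
proof -
  have "fact k * fact n * (n + k choose k) = fact (n + k)"
    using binomial_fact_lemma[of k "n + k"] by simp
  then have "(fact (n + k) :: real) = fact k * fact n * real (n + k choose k)"
    by (metis of_nat_fact of_nat_mult)
  also have "\<dots> \<le> fact k * fact n * 2 ^ (n + k)"
  proof (rule mult_left_mono)
    have "real (n + k choose k) \<le> real (2 ^ (n + k))"
      unfolding of_nat_le_iff by (rule binomial_le_pow2)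
    then show "real (n + k choose k) \<le> 2 ^ (n + k)" by simp
  qed simp
  finally show ?thesis by (simp add: pos_divide_le_eq mult_ac)
qed

text \<open>This is the series of the n-th derivative of the Mittag-Leffler function at
  \<open>z\<close>. It is dominated by the Mittag-Leffler series at \<open>2 * (z + 1)\<close>; as
  \<open>z + 1 \<ge> 1\<close>, the exponent \<open>k\<close> can be raised to
  \<open>n + k\<close>.\<close>

lemma summable_mittag_leffler_derivative:
  fixes \<beta> z :: real
  assumes \<beta>: "0 < \<beta>" and z: "0 \<le> z"
  shows "summable (\<lambda>k. fact (n + k) / fact k * (z ^ k / Gamma (\<beta> * real (n + k) + 1)))"
proof (rule summable_comparison_test')
  have "summable (\<lambda>m. fact n * ((2 * (z + 1)) ^ m / Gamma (\<beta> * real m + 1)))"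
    by (rule summable_mult, rule summable_mittag_leffler[OF \<beta>]) (use z in simp)
  then have "summable (\<lambda>k. fact n * ((2 * (z + 1)) ^ (k + n) / Gamma (\<beta> * real (k + n) + 1)))"
    by (subst summable_iff_shift[where f = "\<lambda>m. fact n * ((2 * (z + 1)) ^ m / Gamma (\<beta> * real m + 1))"])
  then show "summable (\<lambda>k. fact n * ((2 * (z + 1)) ^ (n + k) / Gamma (\<beta> * real (n + k) + 1)))"
    by (simp only: add.commute[of n])
  fix k :: nat
  have G: "0 < Gamma (\<beta> * real (n + k) + 1)"
    using \<beta> by (intro Gamma_real_pos) (simp add: add_nonneg_pos)
  have "fact (n + k) / fact k * z ^ k \<le> (fact n * 2 ^ (n + k)) * (z + 1) ^ (n + k)"
  proof (rule mult_mono[OF fact_ratio_le])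
    have "z ^ k \<le> (z + 1) ^ k" using z by (intro power_mono) auto
    also have "\<dots> \<le> (z + 1) ^ (n + k)" using z by (intro power_increasing) auto
    finally show "z ^ k \<le> (z + 1) ^ (n + k)" .
  qed (use z in auto)
  also have "\<dots> = fact n * (2 * (z + 1)) ^ (n + k)"
    by (simp only: power_mult_distrib mult_ac)
  finally have "fact (n + k) / fact k * z ^ k / Gamma (\<beta> * real (n + k) + 1)
      \<le> fact n * (2 * (z + 1)) ^ (n + k) / Gamma (\<beta> * real (n + k) + 1)"
    using G by (intro divide_right_mono) auto
  then show "norm (fact (n + k) / fact k * (z ^ k / Gamma (\<beta> * real (n + k) + 1)))
      \<le> fact n * ((2 * (z + 1)) ^ (n + k) / Gamma (\<beta> * real (n + k) + 1))"
    using G z by (simp add: abs_mult)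
qed

text \<open>A single term of the exponential series is at most its sum.\<close>

lemma exp_mult_power_le:
  fixes z u :: real
  assumes "0 < z" "0 \<le> u"
  shows "exp (- z * u) * u ^ n \<le> fact n / z ^ n"
proof -
  have "(z * u) ^ n / fact n \<le> (\<Sum>k. (z * u) ^ k /\<^sub>R fact k)"
    using sum_le_suminf[OF summable_exp_generic[of "z * u"], of "{n}"] assms
    by (simp add: divide_inverse mult.commute)
  then have "(z * u) ^ n / fact n \<le> exp (z * u)" by (simp add: exp_def)
  then show ?thesis using assms
    by (simp add: power_mult_distrib exp_minus field_simps)
qed

text \<open>\<open>V\<close> has the moments of the inverse \<open>\<beta>\<close>-stable subordinator at time \<open>1\<close>; up to the factor
  \<open>z ^ n / n!\<close>, \<open>mixture n z (x powr \<beta>)\<close> is the probability that the fractional Poisson process of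
  rate \<open>z\<close> has value \<open>n\<close> at time \<open>x\<close>.\<close>

locale mittag_leffler_variable = prob_space +
  fixes \<beta> :: real and V :: "'a \<Rightarrow> real"
  assumes \<beta>: "0 < \<beta>"
    and V_meas[measurable]: "V \<in> borel_measurable M"
    and V_nonneg: "\<And>\<omega>. 0 \<le> V \<omega>"
    and V_int: "\<And>m. integrable M (\<lambda>\<omega>. V \<omega> ^ m)"
    and V_moment: "\<And>m. (\<integral>\<omega>. V \<omega> ^ m \<partial>M) = fact m / Gamma (\<beta> * real m + 1)"
begin

definition mixture :: "nat \<Rightarrow> real \<Rightarrow> real \<Rightarrow> real" where
  "mixture n z y = (\<integral>\<omega>. exp (- z * (y * V \<omega>)) * (y * V \<omega>) ^ n \<partial>M)"

lemma mixture_measurable[measurable]: "mixture n z \<in> borel_measurable borel"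
  unfolding mixture_def[abs_def] by measurable

lemma mixture_integrand_le:
  assumes "0 \<le> y" "0 \<le> z"
  shows "norm (exp (- z * (y * V \<omega>)) * (y * V \<omega>) ^ n) \<le> y ^ n * V \<omega> ^ n"
  using assms V_nonneg[of \<omega>]
  by (simp add: abs_mult power_mult_distrib mult_left_le_one_le)

lemma mixture_integrable:
  assumes "0 \<le> y" "0 \<le> z"
  shows "integrable M (\<lambda>\<omega>. exp (- z * (y * V \<omega>)) * (y * V \<omega>) ^ n)"
proof (rule Bochner_Integration.integrable_bound)
  show "integrable M (\<lambda>\<omega>. y ^ n * V \<omega> ^ n)" by (intro integrable_mult_right V_int)
  show "AE \<omega> in M. norm (exp (- z * (y * V \<omega>)) * (y * V \<omega>) ^ n) \<le> norm (y ^ n * V \<omega> ^ n)"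
    by (rule AE_I2, rule order_trans[OF mixture_integrand_le[OF assms]]) simp
qed measurable

text \<open>The bound is free of \<open>y\<close>, so a constant dominates once the random
  \<open>Y\<close> is inserted.\<close>

lemma mixture_bound:
  assumes "0 \<le> y" "0 < z"
  shows "\<bar>mixture n z y\<bar> \<le> fact n / z ^ n"
proof -
  have "0 \<le> mixture n z y"
    unfolding mixture_def using assms V_nonneg by (intro Bochner_Integration.integral_nonneg) auto
  moreover have "mixture n z y \<le> (\<integral>\<omega>. fact n / z ^ n \<partial>M)"
    unfolding mixture_def using assms V_nonneg
    by (intro integral_mono mixture_integrable exp_mult_power_le) auto
  ultimately show ?thesis using prob_space by simp
qed

lemma mixture_continuous:
  assumes y: "0 \<le> y" and z: "z \<longlonglongrightarrow> r" "\<And>j::nat. 0 \<le> z j"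
  shows "(\<lambda>j. mixture n (z j) y) \<longlonglongrightarrow> mixture n r y"
  unfolding mixture_def
proof (rule integral_dominated_convergence)
  show "integrable M (\<lambda>\<omega>. y ^ n * V \<omega> ^ n)" by (intro integrable_mult_right V_int)
  show "AE \<omega> in M. norm (exp (- z j * (y * V \<omega>)) * (y * V \<omega>) ^ n) \<le> y ^ n * V \<omega> ^ n" for j
    by (intro AE_I2 mixture_integrand_le y z)
  show "AE \<omega> in M. (\<lambda>j. exp (- z j * (y * V \<omega>)) * (y * V \<omega>) ^ n) \<longlonglongrightarrow> exp (- r * (y * V \<omega>)) * (y * V \<omega>) ^ n"
    by (intro always_eventually allI tendsto_intros z)
qed measurable

text \<open>Expand the exponential and integrate termwise with the moments of \<open>V\<close>. For
  fixed \<open>y\<close> the absolute series is \<open>y ^ n\<close> times a Mittag-Leffler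
  derivative at \<open>z * y\<close>, so it converges at every rate.\<close>

lemma mixture_sums:
  assumes y: "0 \<le> y" and z: "0 \<le> z"
  shows "(\<lambda>k. fact (n + k) / fact k * ((- z) ^ k / Gamma (\<beta> * real (n + k) + 1)) * y ^ (n + k)) sums mixture n z y"
    and "summable (\<lambda>k. norm (fact (n + k) / fact k * ((- z) ^ k / Gamma (\<beta> * real (n + k) + 1)) * y ^ (n + k)))"
proof -
  define f where "f k \<omega> = (- z) ^ k / fact k * (y * V \<omega>) ^ (n + k)" for k \<omega>
  have G: "0 < Gamma (\<beta> * real m + 1)" for m
    using \<beta> by (intro Gamma_real_pos) (simp add: add_nonneg_pos)
  have fsums: "(\<lambda>k. f k \<omega>) sums (exp (- z * (y * V \<omega>)) * (y * V \<omega>) ^ n)" for \<omega>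
  proof -
    have "(\<lambda>k. (- z * (y * V \<omega>)) ^ k /\<^sub>R fact k * (y * V \<omega>) ^ n) sums (exp (- z * (y * V \<omega>)) * (y * V \<omega>) ^ n)"
      by (intro sums_mult2 exp_converges)
    moreover have "(- z * (y * V \<omega>)) ^ k /\<^sub>R fact k * (y * V \<omega>) ^ n = f k \<omega>" for k
      unfolding f_def power_mult_distrib power_add by (simp add: divide_inverse mult_ac)
    ultimately show ?thesis by simp
  qed
  have f_norm: "norm (f k \<omega>) = z ^ k / fact k * y ^ (n + k) * V \<omega> ^ (n + k)" for k \<omega>
    using y z V_nonneg[of \<omega>] by (simp add: f_def abs_mult power_abs power_mult_distrib)
  have int_f: "integrable M (f k)" for k
    unfolding f_def[abs_def] power_mult_distrib by (intro integrable_mult_right V_int)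
  have integral_f: "(\<integral>\<omega>. f k \<omega> \<partial>M) = fact (n + k) / fact k * ((- z) ^ k / Gamma (\<beta> * real (n + k) + 1)) * y ^ (n + k)" for k
    unfolding f_def power_mult_distrib by (simp add: V_moment mult_ac)
  have norm_f: "(\<integral>\<omega>. norm (f k \<omega>) \<partial>M) = fact (n + k) / fact k * (z ^ k / Gamma (\<beta> * real (n + k) + 1)) * y ^ (n + k)" for k
    unfolding f_norm by (simp add: V_moment mult_ac)
  have norm_eq: "fact (n + k) / fact k * (z ^ k / Gamma (\<beta> * real (n + k) + 1)) * y ^ (n + k)
      = y ^ n * (fact (n + k) / fact k * ((z * y) ^ k / Gamma (\<beta> * real (n + k) + 1)))" for k
    by (simp add: power_mult_distrib power_add)
  have sn: "summable (\<lambda>k. \<integral>\<omega>. norm (f k \<omega>) \<partial>M)"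
    unfolding norm_f norm_eq using y z
    by (intro summable_mult summable_mittag_leffler_derivative \<beta>) simp
  have "summable (\<lambda>k. norm (f k \<omega>))" for \<omega>
  proof -
    have "summable (\<lambda>k. (z * (y * V \<omega>)) ^ k /\<^sub>R fact k * (y * V \<omega>) ^ n)"
      by (intro summable_mult2 summable_exp_generic)
    moreover have "(z * (y * V \<omega>)) ^ k /\<^sub>R fact k * (y * V \<omega>) ^ n = norm (f k \<omega>)" for k
      unfolding f_norm power_mult_distrib power_add by (simp add: divide_inverse mult_ac)
    ultimately show ?thesis by simp
  qed
  then have "(\<lambda>k. \<integral>\<omega>. f k \<omega> \<partial>M) sums (\<integral>\<omega>. (\<Sum>k. f k \<omega>) \<partial>M)"
    by (intro sums_integral int_f sn) auto
  then show "(\<lambda>k. fact (n + k) / fact k * ((- z) ^ k / Gamma (\<beta> * real (n + k) + 1)) * y ^ (n + k)) sums mixture n z y"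
    unfolding integral_f by (simp add: sums_unique[OF fsums, symmetric] mixture_def)
  have "norm (fact (n + k) / fact k * ((- z) ^ k / Gamma (\<beta> * real (n + k) + 1)) * y ^ (n + k)) = (\<integral>\<omega>. norm (f k \<omega>) \<partial>M)" for k
    unfolding norm_f using y z G[of "n + k"] by (simp add: abs_mult power_abs)
  then show "summable (\<lambda>k. norm (fact (n + k) / fact k * ((- z) ^ k / Gamma (\<beta> * real (n + k) + 1)) * y ^ (n + k)))"
    using sn by simp
qed

lemma expectation_mixture:
  assumes Y[measurable]: "Y \<in> borel_measurable M" and Y_nonneg: "AE \<omega> in M. 0 \<le> Y \<omega>"
    and Y_int: "\<And>m. integrable M (\<lambda>\<omega>. Y \<omega> ^ m)" and r: "0 < r"
    and summ: "summable (\<lambda>k. fact (n + k) / fact k * ((- r) ^ k / Gamma (\<beta> * real (n + k) + 1)) * (\<integral>\<omega>. Y \<omega> ^ (n + k) \<partial>M))"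
  shows "(\<integral>\<omega>. mixture n r (Y \<omega>) \<partial>M) =
    (\<Sum>k. fact (n + k) / fact k * ((- r) ^ k / Gamma (\<beta> * real (n + k) + 1)) * (\<integral>\<omega>. Y \<omega> ^ (n + k) \<partial>M))"
proof -
  define b where "b k = fact (n + k) / fact k / Gamma (\<beta> * real (n + k) + 1)" for k
  define \<mu> where "\<mu> m = (\<integral>\<omega>. Y \<omega> ^ m \<partial>M)" for m
  have b: "fact (n + k) / fact k * (w / Gamma (\<beta> * real (n + k) + 1)) = b k * w" for k w
    by (simp add: b_def)
  have b0: "0 \<le> b k" for k
    unfolding b_def using \<beta> by (intro divide_nonneg_nonneg Gamma_real_nonneg) (auto simp: add_nonneg_pos)
  have \<mu>0: "0 \<le> \<mu> m" for m
    unfolding \<mu>_def using Y_nonneg by (intro Bochner_Integration.integral_nonneg_AE) auto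
  have summ': "summable (\<lambda>k. b k * \<mu> (n + k) * (- r) ^ k)"
    using summ unfolding b \<mu>_def by (simp add: mult_ac)
  have small: "(\<integral>\<omega>. mixture n z (Y \<omega>) \<partial>M) = (\<Sum>k. b k * \<mu> (n + k) * (- z) ^ k)" if z: "0 \<le> z" "z < r" for z
  proof -
    have norm: "(\<integral>\<omega>. norm (b k * (- z) ^ k * Y \<omega> ^ (n + k)) \<partial>M) = norm (b k * \<mu> (n + k) * (- z) ^ k)" for k
    proof -
      have "(\<integral>\<omega>. norm (b k * (- z) ^ k * Y \<omega> ^ (n + k)) \<partial>M) = (\<integral>\<omega>. b k * z ^ k * Y \<omega> ^ (n + k) \<partial>M)"
      proof (rule integral_cong_AE)
        show "AE \<omega> in M. norm (b k * (- z) ^ k * Y \<omega> ^ (n + k)) = b k * z ^ k * Y \<omega> ^ (n + k)"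
          using Y_nonneg by eventually_elim (use b0[of k] z in \<open>simp add: abs_mult power_abs\<close>)
      qed measurable
      then show ?thesis using b0[of k] z \<mu>0[of "n + k"] by (simp add: \<mu>_def abs_mult power_abs)
    qed
    have "(\<integral>\<omega>. mixture n z (Y \<omega>) \<partial>M) = (\<integral>\<omega>. (\<Sum>k. b k * (- z) ^ k * Y \<omega> ^ (n + k)) \<partial>M)"
    proof (rule integral_cong_AE)
      show "AE \<omega> in M. mixture n z (Y \<omega>) = (\<Sum>k. b k * (- z) ^ k * Y \<omega> ^ (n + k))"
        using Y_nonneg
      proof eventually_elim
        case (elim \<omega>)
        show ?case using mixture_sums(1)[OF elim z(1), of n] unfolding b by (simp add: sums_iff)
      qed
    qed measurable
    also have "\<dots> = (\<Sum>k. \<integral>\<omega>. b k * (- z) ^ k * Y \<omega> ^ (n + k) \<partial>M)"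
    proof (rule integral_suminf)
      show "integrable M (\<lambda>\<omega>. b k * (- z) ^ k * Y \<omega> ^ (n + k))" for k
        by (intro integrable_mult_right Y_int)
      show "AE \<omega> in M. summable (\<lambda>k. norm (b k * (- z) ^ k * Y \<omega> ^ (n + k)))"
        using Y_nonneg
      proof eventually_elim
        case (elim \<omega>)
        show ?case using mixture_sums(2)[OF elim z(1), of n] unfolding b .
      qed
      \<comment> \<open>Convergence of the power series at \<open>- r\<close> forces absolute
        convergence at every smaller modulus.\<close>
      show "summable (\<lambda>k. \<integral>\<omega>. norm (b k * (- z) ^ k * Y \<omega> ^ (n + k)) \<partial>M)"
        unfolding norm using z r by (intro powser_insidea[OF summ']) simp
    qed
    finally show ?thesis by (simp add: \<mu>_def mult_ac)
  qed
  \<comment> \<open>The offset 2 keeps \<open>x j \<ge> 1 / 2\<close>, so that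
    \<open>fact n / (r / 2) ^ n\<close> dominates for all \<open>j\<close>; an offset of 1 would
    start at rate 0.\<close>
  define x where "x j = 1 - 1 / real (j + 2)" for j
  have x: "1 / 2 \<le> x j" "x j < 1" for j by (simp_all add: x_def field_simps)
  have x0: "0 \<le> x j" for j using x(1)[of j] by simp
  have x_lim: "x \<longlonglongrightarrow> 1" unfolding x_def by real_asymp
  have "(\<lambda>j. \<Sum>k. b k * \<mu> (n + k) * (- r) ^ k * x j ^ k) \<longlonglongrightarrow> (\<Sum>k. b k * \<mu> (n + k) * (- r) ^ k)"
    by (rule abel_limit[OF summ' x_lim x0 x(2)])
  moreover have "(\<Sum>k. b k * \<mu> (n + k) * (- r) ^ k * x j ^ k) = (\<integral>\<omega>. mixture n (r * x j) (Y \<omega>) \<partial>M)" for j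
  proof -
    have "(- r) ^ k * x j ^ k = (- (r * x j)) ^ k" for k
      by (simp add: power_mult_distrib[symmetric])
    then show ?thesis
      using r x(2)[of j] x0[of j] by (subst small) (auto simp: mult.assoc)
  qed
  moreover have "(\<lambda>j. \<integral>\<omega>. mixture n (r * x j) (Y \<omega>) \<partial>M) \<longlonglongrightarrow> (\<integral>\<omega>. mixture n r (Y \<omega>) \<partial>M)"
  proof (rule integral_dominated_convergence)
    show "AE \<omega> in M. (\<lambda>j. mixture n (r * x j) (Y \<omega>)) \<longlonglongrightarrow> mixture n r (Y \<omega>)"
      using Y_nonneg
    proof eventually_elim
      case (elim \<omega>)
      have "(\<lambda>j. r * x j) \<longlonglongrightarrow> r * 1" by (intro tendsto_intros x_lim)
      then show ?case using r x0 by (intro mixture_continuous elim) auto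
    qed
    show "AE \<omega> in M. norm (mixture n (r * x j) (Y \<omega>)) \<le> fact n / (r / 2) ^ n" for j
      using Y_nonneg
    proof eventually_elim
      case (elim \<omega>)
      have rx: "r / 2 \<le> r * x j" using r x(1)[of j] mult_left_mono[of "1/2" "x j" r] by simp
      have "norm (mixture n (r * x j) (Y \<omega>)) \<le> fact n / (r * x j) ^ n"
        using mixture_bound[OF elim, of "r * x j" n] rx r by simp
      also have "\<dots> \<le> fact n / (r / 2) ^ n"
        using rx r by (intro divide_left_mono power_mono mult_pos_pos zero_less_power) auto
      finally show ?case .
    qed
    show "integrable M (\<lambda>\<omega>. fact n / (r / 2) ^ n)" by simp
  qed measurable
  ultimately show ?thesis
    unfolding b \<mu>_def[symmetric] by (simp add: LIMSEQ_unique mult_ac)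
qed

end

section \<open>The fractional Poisson process\<close>

lemma indep_processes_measurable:
  assumes "prob_space M" "indep_processes M X Y" "0 \<le> t"
  shows "Y t \<in> borel_measurable (completion M)"
proof -
  interpret P: prob_space M by fact
  interpret C: prob_space "completion M"
    by (intro prob_spaceI) (simp add: P.emeasure_space_1)
  have "(\<lambda>\<omega>. \<lambda>t\<in>{0..}. Y t \<omega>) \<in> measurable (completion M) (\<Pi>\<^sub>M t\<in>{0..}. borel)"
    using C.indep_var_rv2 assms(2) unfolding indep_processes_def by blast
  from measurable_compose[OF this measurable_component_singleton[of t]] assms(3)
  show ?thesis by simp
qed

lemma poisson_process_right_continuous:
  assumes "poisson_process M r N"
  shows "AE \<omega> in M. \<forall>s\<ge>0. continuous (at_right s) (\<lambda>s. real (N s \<omega>))"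
  using assms unfolding poisson_process_def levy_process_def cadlag_def by auto

lemma (in prob_space) poisson_process_marginal:
  assumes N: "poisson_process M r N" and r: "0 < r" and s: "0 \<le> s"
  shows "measure (completion M) {\<omega> \<in> space M. N s \<omega> = n} = r ^ n / fact n * (exp (- r * s) * s ^ n)"
proof -
  have [measurable]: "(\<lambda>\<omega>. real (N s \<omega>)) \<in> borel_measurable M"
    using N s by (auto simp: poisson_process_def levy_process_def)
  have ev: "{\<omega> \<in> space M. N s \<omega> = k} \<in> sets M" for k
  proof -
    have "{\<omega> \<in> space M. real (N s \<omega>) = real k} \<in> sets M" by measurable
    then show ?thesis by simp
  qed
  have "measure (completion M) {\<omega> \<in> space M. N s \<omega> = n} = prob {\<omega> \<in> space M. N s \<omega> = n}"
    by (rule measure_completion) (rule ev)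
  also have "\<dots> = r ^ n / fact n * (exp (- r * s) * s ^ n)"
  \<comment> \<open>\<open>poisson_process\<close> prescribes the law at positive times; at time 0
    the process vanishes almost surely, in accordance with \<open>0 ^ 0 = 1\<close> in the
    formula.\<close>
  proof (cases "s = 0")
    case True
    have "AE \<omega> in M. N 0 \<omega> = 0"
      using N by (auto simp: poisson_process_def levy_process_def)
    then have AE: "AE \<omega> in M. N s \<omega> = 0" using True by simp
    show ?thesis
    proof (cases "n = 0")
      case True
      have "prob {\<omega> \<in> space M. N s \<omega> = n} = 1"
        using AE ev[of n] True by (subst prob_Collect_eq_1) auto
      then show ?thesis using True \<open>s = 0\<close> by simp
    next
      case False
      have "AE \<omega> in M. N s \<omega> \<noteq> n" using AE False by auto
      then have "prob {\<omega> \<in> space M. N s \<omega> = n} = 0"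
        using ev[of n] by (subst prob_Collect_eq_0) auto
      then show ?thesis using False \<open>s = 0\<close> by simp
    qed
  next
    case False
    with s have s: "0 < s" by simp
    have "N s \<in> measurable M (count_space UNIV)"
      using ev by (auto simp: measurable_count_space_eq_countable vimage_def Int_def conj_commute)
    then have "prob {\<omega> \<in> space M. N s \<omega> = n} = measure (distr M (count_space UNIV) (N s)) {n}"
      by (subst measure_distr) (auto intro!: arg_cong[where f = prob])
    also have "\<dots> = pmf (poisson_pmf (r * s)) n"
      using N s by (simp add: poisson_process_def pmf.rep_eq)
    also have "\<dots> = r ^ n / fact n * (exp (- r * s) * s ^ n)"
      using r s by (simp add: power_mult_distrib)
    finally show ?thesis .
  qed
  finally show ?thesis .
qed

text \<open>In the time change by \<open>D\<^sub>f\<close> this process is the outer one, so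
  \<open>random_time_distribution\<close> asks for its path regularity as well.\<close>

lemma (in prob_space) fractional_poisson_process_right_continuous:
  assumes "fractional_poisson_process M \<beta> r N"
  shows "AE \<omega> in M. \<forall>s\<ge>0. continuous (at_right s) (\<lambda>s. real (N s \<omega>))"
proof (cases "\<beta> = 1")
  case True
  then show ?thesis
    using assms poisson_process_right_continuous by (auto simp: fractional_poisson_process_def)
next
  case False
  then obtain D N0 where D: "subordinator M (\<lambda>s. s powr \<beta>) D" and N0: "poisson_process M r N0"
    and N: "\<And>t \<omega>. 0 \<le> t \<Longrightarrow> \<omega> \<in> space M \<Longrightarrow> N t \<omega> = time_change N0 (inverse_process D) t \<omega>"
    using assms unfolding fractional_poisson_process_def by auto
  show ?thesis
    using stable_unbounded[OF D] poisson_process_right_continuous[OF N0] AE_space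
  proof eventually_elim
    case (elim \<omega>)
    show ?case
    proof (intro allI impI)
      fix s :: real assume s: "0 \<le> s"
      have "continuous (at_right s) (\<lambda>s. real (time_change N0 (inverse_process D) s \<omega>))"
        using elim by (intro continuous_at_right_time_change_inverse) auto
      moreover have "eventually (\<lambda>t. real (N t \<omega>) = real (time_change N0 (inverse_process D) t \<omega>)) (at_right s)"
        using eventually_at_right_less[of s] by eventually_elim (use s elim in \<open>simp add: N\<close>)
      ultimately show "continuous (at_right s) (\<lambda>s. real (N s \<omega>))"
        unfolding continuous_within N[OF s elim(3)] by (simp only: tendsto_cong)
    qed
  qed
qed

text \<open>One \<open>V\<close> serves all \<open>s\<close> and \<open>n\<close>: by
  self-similarity the dependence on \<open>s\<close> is confined to the factor
  \<open>s powr \<beta>\<close>. For \<beta> = 1 the constant 1 has the required moments m! /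
  \<Gamma> (m + 1) = 1.\<close>

lemma (in prob_space) fractional_poisson_process_marginal:
  assumes fpp: "fractional_poisson_process M \<beta> r N" and \<beta>: "0 < \<beta>" and r: "0 < r"
  obtains V where "mittag_leffler_variable M \<beta> V"
    "\<And>s n. 0 \<le> s \<Longrightarrow> measure (completion M) {\<omega> \<in> space M. N s \<omega> = n} =
      r ^ n / fact n * mittag_leffler_variable.mixture M V n r (s powr \<beta>)"
proof (cases "\<beta> = 1")
  case True
  have mlv: "mittag_leffler_variable M \<beta> (\<lambda>_. 1)"
  proof
    fix m :: nat
    have "Gamma (\<beta> * real m + 1) = fact m"
      using True Gamma_fact[of m, where 'a = real] by (simp add: add.commute)
    then show "(\<integral>\<omega>. 1 ^ m \<partial>M) = fact m / Gamma (\<beta> * real m + 1)"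
      by (simp add: prob_space)
  qed (use \<beta> in auto)
  have N: "poisson_process M r N"
    using fpp True by (simp add: fractional_poisson_process_def)
  show thesis
    by (rule that[OF mlv])
      (use True in \<open>simp add: poisson_process_marginal[OF N r] mittag_leffler_variable.mixture_def[OF mlv] prob_space\<close>)
next
  case False
  then obtain D N0 where D: "subordinator M (\<lambda>s. s powr \<beta>) D" and N0: "poisson_process M r N0"
    and ind: "indep_processes M (\<lambda>t \<omega>. real (N0 t \<omega>)) (inverse_process D)"
    and N: "\<And>t \<omega>. 0 \<le> t \<Longrightarrow> \<omega> \<in> space M \<Longrightarrow> N t \<omega> = time_change N0 (inverse_process D) t \<omega>"
    using fpp unfolding fractional_poisson_process_def by auto
  define V where "V \<omega> = D 1 \<omega> powr (- \<beta>)" for \<omega>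
  have [measurable]: "D 1 \<in> borel_measurable M" using subordinator_measurable[OF D] by auto
  have mlv: "mittag_leffler_variable M \<beta> V"
    by standard (use stable_negative_moments[OF D \<beta>] \<beta> in \<open>auto simp: V_def[abs_def]\<close>)
  interpret V: mittag_leffler_variable M \<beta> V by fact
  have "measure (completion M) {\<omega> \<in> space M. N s \<omega> = n} = r ^ n / fact n * V.mixture n r (s powr \<beta>)"
    if s: "0 \<le> s" for s n
  proof -
    define q where "q u = r ^ n / fact n * (exp (- r * u) * u ^ n)" for u
    have q[measurable]: "q \<in> borel_measurable borel" unfolding q_def[abs_def] by measurable
    have E: "inverse_process D s \<in> borel_measurable (completion M)"
      by (rule indep_processes_measurable[OF prob_space_axioms ind s])
    have W[measurable]: "(\<lambda>\<omega>. s powr \<beta> * V \<omega>) \<in> borel_measurable M" by measurable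
    note WC = measurable_completion[OF W]
    have "measure (completion M) {\<omega> \<in> space M. N s \<omega> = n}
        = measure (completion M) {\<omega> \<in> space M. time_change N0 (inverse_process D) s \<omega> = n}"
      using s by (intro arg_cong[where f = "measure (completion M)"]) (auto simp: N)
    also have "\<dots> = (\<integral>\<omega>. q (inverse_process D s \<omega>) \<partial>completion M)"
    proof (rule random_time_distribution[OF prob_space_axioms ind _ s])
      show "AE \<omega> in M. \<forall>s\<ge>0. continuous (at_right s) (\<lambda>s. real (N0 s \<omega>))"
        by (rule poisson_process_right_continuous[OF N0])
      show "AE \<omega> in M. 0 \<le> inverse_process D s \<omega>"
        using stable_unbounded[OF D] by eventually_elim (auto intro!: inverse_process_nonneg)
      show "measure (completion M) {\<omega> \<in> space M. N0 u \<omega> = n} = q u" if "0 \<le> u" for u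
        unfolding q_def by (rule poisson_process_marginal[OF N0 r that])
    qed measurable
    also have "\<dots> = (\<integral>u. q u \<partial>distr (completion M) borel (inverse_process D s))"
      by (rule integral_distr[OF E q, symmetric])
    \<comment> \<open>Only the law of the inverse at the fixed time \<open>s\<close> matters here,
      so it may be replaced by \<open>s powr \<beta> * V\<close>.\<close>
    also have "\<dots> = (\<integral>u. q u \<partial>distr (completion M) borel (\<lambda>\<omega>. s powr \<beta> * V \<omega>))"
      unfolding inverse_stable_distribution[OF D \<beta> s E] V_def ..
    also have "\<dots> = (\<integral>\<omega>. q (s powr \<beta> * V \<omega>) \<partial>completion M)"
      by (rule integral_distr[OF WC q])
    also have "\<dots> = (\<integral>\<omega>. q (s powr \<beta> * V \<omega>) \<partial>M)"
      by (rule integral_completion) measurable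
    also have "\<dots> = r ^ n / fact n * V.mixture n r (s powr \<beta>)"
      unfolding q_def V.mixture_def by simp
    finally show ?thesis .
  qed
  then show thesis by (rule that[OF mlv])
qed

theorem theorem3p1:
  fixes M :: "'a measure"
    and \<beta> r :: real
    and f :: "real \<Rightarrow> real"
    and N\<^sub>\<beta> :: "real \<Rightarrow> 'a \<Rightarrow> nat"
    and D\<^sub>f :: "real \<Rightarrow> 'a \<Rightarrow> real"
    and t :: real
    and n :: nat
  assumes "prob_space M"
    and "0 < \<beta>" and "\<beta> \<le> 1" and "0 < r"
    and "fractional_poisson_process M \<beta> r N\<^sub>\<beta>"
    and "subordinator M f D\<^sub>f"
    and "indep_processes M (\<lambda>s \<omega>. real (N\<^sub>\<beta> s \<omega>)) D\<^sub>f"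
    and "\<And>s \<rho>. 0 \<le> s \<Longrightarrow> 0 < \<rho> \<Longrightarrow> integrable M (\<lambda>\<omega>. real_power (D\<^sub>f s \<omega>) \<rho>)"
    and "0 \<le> t"
    and series_converges:
      "summable (\<lambda>k. fact (n + k) / fact k * ((- r) ^ k / Gamma (\<beta> * real (k + n) + 1)) *
         fractional_moment M (D\<^sub>f t) (\<beta> * real (n + k)))"
  shows "measure (completion M) {\<omega> \<in> space M. time_change N\<^sub>\<beta> D\<^sub>f t \<omega> = n} =
    r ^ n / fact n *
      (\<Sum>k. fact (n + k) / fact k * ((- r) ^ k / Gamma (\<beta> * real (k + n) + 1)) *
         fractional_moment M (D\<^sub>f t) (\<beta> * real (n + k)))"
proof -
  interpret prob_space M by fact
  obtain V where mlv: "mittag_leffler_variable M \<beta> V"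
    and marginal: "\<And>s n. 0 \<le> s \<Longrightarrow> measure (completion M) {\<omega> \<in> space M. N\<^sub>\<beta> s \<omega> = n} =
      r ^ n / fact n * mittag_leffler_variable.mixture M V n r (s powr \<beta>)"
    using fractional_poisson_process_marginal[OF assms(5,2,4)] by blast
  interpret V: mittag_leffler_variable M \<beta> V by fact
  have D_meas[measurable]: "D\<^sub>f t \<in> borel_measurable M"
    by (rule subordinator_measurable[OF assms(6,9)])
  have D_nonneg: "AE \<omega> in M. 0 \<le> D\<^sub>f t \<omega>"
    by (rule subordinator_nonneg[OF assms(6,9)])
  \<comment> \<open>Moments of order \<open>\<beta> * m\<close> become integer powers of
    \<open>Y\<close>. On \<open>{D\<^sub>f t = 0}\<close> the value of \<open>Y ^ 0\<close> is 1,
    which is the convention of \<open>real_power\<close>.\<close>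
  define Y where "Y \<omega> = D\<^sub>f t \<omega> powr \<beta>" for \<omega>
  have Y_meas[measurable]: "Y \<in> borel_measurable M" unfolding Y_def[abs_def] by measurable
  have Y_power: "AE \<omega> in M. real_power (D\<^sub>f t \<omega>) (\<beta> * real m) = Y \<omega> ^ m" for m
    using D_nonneg
  proof eventually_elim
    case (elim \<omega>)
    show ?case
    proof (cases "m = 0 \<or> D\<^sub>f t \<omega> = 0")
      case True
      then show ?thesis using assms(2) by (auto simp: real_power_def Y_def)
    next
      case False
      then show ?thesis using assms(2) elim by (simp add: real_power_def Y_def powr_power mult.commute)
    qed
  qed
  have rp_meas[measurable]: "(\<lambda>\<omega>. real_power (D\<^sub>f t \<omega>) \<rho>) \<in> borel_measurable M" for \<rho>
    unfolding real_power_def by (cases "\<rho> = 0") auto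
  have moment: "fractional_moment M (D\<^sub>f t) (\<beta> * real m) = (\<integral>\<omega>. Y \<omega> ^ m \<partial>M)" for m
    unfolding fractional_moment_def by (rule integral_cong_AE) (use Y_power in auto)
  have Y_int: "integrable M (\<lambda>\<omega>. Y \<omega> ^ m)" for m
  \<comment> \<open>The moment hypothesis concerns positive orders; order 0 is the integral of
    1.\<close>
  proof (cases "m = 0")
    case False
    then have "integrable M (\<lambda>\<omega>. real_power (D\<^sub>f t \<omega>) (\<beta> * real m))"
      using assms(2,9) by (intro assms(8)) auto
    then show ?thesis
      by (rule integrable_cong_AE_imp) (use Y_power[of m] in auto)
  qed simp
  define q where "q s = r ^ n / fact n * V.mixture n r (s powr \<beta>)" for s
  have [measurable]: "q \<in> borel_measurable borel" unfolding q_def[abs_def] by measurable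
  have "measure (completion M) {\<omega> \<in> space M. time_change N\<^sub>\<beta> D\<^sub>f t \<omega> = n} = (\<integral>\<omega>. q (D\<^sub>f t \<omega>) \<partial>completion M)"
    by (rule random_time_distribution[OF assms(1,7) _ assms(9) D_nonneg])
      (auto simp: q_def marginal intro: fractional_poisson_process_right_continuous[OF assms(5)])
  also have "\<dots> = (\<integral>\<omega>. q (D\<^sub>f t \<omega>) \<partial>M)"
    by (rule integral_completion) measurable
  also have "\<dots> = r ^ n / fact n * (\<integral>\<omega>. V.mixture n r (Y \<omega>) \<partial>M)"
    by (simp add: q_def Y_def)
  also have "(\<integral>\<omega>. V.mixture n r (Y \<omega>) \<partial>M) =
    (\<Sum>k. fact (n + k) / fact k * ((- r) ^ k / Gamma (\<beta> * real (n + k) + 1)) * (\<integral>\<omega>. Y \<omega> ^ (n + k) \<partial>M))"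
    using series_converges unfolding moment
    by (intro V.expectation_mixture Y_int assms(4)) (auto simp: Y_def add.commute)
  finally show ?thesis unfolding moment by (simp add: add.commute)
qed

end
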